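(* Let $\mathcal{T}$ be a T-mesh, let $\mathbf{r}$ be a smoothness distribution on $\mathcal{T}$, and let $m,m'\in\mathbb{N}$. Let $\iota$ be a fixed ordering of the set of maximal interior segments of $\mathcal{T}$, and let $\omega=\omega_\iota$ be the associated weight. Then $$0\le h_{m,m'}^{\mathbf{r}}(\mathcal{T})\le\sum_{\rho\in \mathrm{MIS}_h(\mathcal{T})}(m+1-\omega(\rho))_+\,(m'-\mathbf{r}(\rho))+\sum_{\rho\in \mathrm{MIS}_v(\mathcal{T})}(m-\mathbf{r}(\rho))\,(m'+1-\omega(\rho))_+ ,$$ where $a_+=\max(0,a)$.
   Context: T-mesh. A T-mesh $\mathcal{T}$ of $\mathbb{R}^2$ consists of a finite set $\mathcal{T}_2$ of closed axis-aligned rectangles (cells), a finite set $\mathcal{T}_1$ of closed axis-aligned segments (edges) contained in $\bigcup_{\sigma\in\mathcal{T}_2}\partial\sigma$, and the finite set $\mathcal{T}_0=\bigcup_{\tau\in\mathcal{T}_1}\partial\tau$ of end points of edges (vertices), such that: for $\sigma\in\mathcal{T}_2$, $\partial\sigma$ is a finite union of elements of $\mathcal{T}_1$; for $\sigma\ne\sigma'$ in $\mathcal{T}_2$, $\sigma\cap\sigma'=\partial\sigma\cap\partial\sigma'$ is a finite union of elements of $\mathcal{T}_1\cup\mathcal{T}_0$; for $\tau\neq\tau'$ in $\mathcal{T}_1$, $\tau\cap\tau'=\partial\tau\cap\partial\tau'\subset\mathcal{T}_0$. The domain is $\Omega=\bigcup_{\sigma\in\mathcal{T}_2}\sigma$,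 with interior $\Omega^\circ$. Edges parallel to the first axis are horizontal, those parallel to the second axis are vertical. Standing assumptions: every vertex belongs to at least one horizontal edge and at least one vertical edge; $\Omega$ is simply connected and $\Omega^\circ$ is connected. An edge is interior if it meets $\Omega^\circ$; $\mathcal{T}_1^o$ is the set of interior edges. A vertex is interior if it lies in $\Omega^\circ$; $\mathcal{T}_0^o$ is the set of interior vertices. Smoothness. Use coordinates $(s,t)$ and $0\in\mathbb N$. Let $\nu_h(\mathcal{T})$ be the set of first coordinates of points of vertical edges and $\nu_v(\mathcal{T})$ the set of second coordinates of points of horizontal edges. A smoothness distribution $\mathbf{r}$ is a pair of maps $\mathbf{r}_h:\nu_h(\mathcal{T})\to\mathbb{N}$, $\mathbf{r}_v:\nu_v(\mathcal{T})\to\mathbb{N}$. For a vertical edge $\tau$ on $s=a$, $\mathbf{r}(\tau)=\mathbf{r}_h(a)$; for a horizontal edge $\tau$ on $t=b$, $\mathbf{r}(\tau)=\mathbf{r}_v(b)$. For a vertex $\gamma=(a,b)$, $\mathbf{r}_h(\gamma)=\mathbf{r}_h(a)$, $\mathbf{r}_v(\gamma)=\mathbf{r}_v(b)$. The number $h$. $R_{m,m'}$ is the space of polynomials in $\mathbb{R}[s,t]$ of degree $\le m$ in $s$ and $\le m'$ in $t$. For an edge $\tau$, let $l_\tau$ be a nonzero polynomial of degree 1 defining the line supporting $\tau$, $\Delta^{\mathbf{r}}(\tau)=l_\tau^{\mathbf{r}(\tau)+1}$, and $\mathfrak{I}^{\mathbf{r}}_{m,m'}(\tau)=(\Delta^{\mathbf{r}}(\tau))\cap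 R_{m,m'}$. For a vertex $\gamma$, $\mathfrak{I}^{\mathbf{r}}_{m,m'}(\gamma)=\mathfrak{I}^{\mathbf{r}}_{m,m'}(\tau_v)+\mathfrak{I}^{\mathbf{r}}_{m,m'}(\tau_h)$ for any vertical edge $\tau_v$ and horizontal edge $\tau_h$ containing $\gamma$. With formal symbols $[\tau]$, $[\gamma]$ and a chosen orientation of each edge, let $$\partial_1:\bigoplus_{\tau\in\mathcal{T}_1^o}[\tau]\,\mathfrak{I}^{\mathbf{r}}_{m,m'}(\tau)\to\bigoplus_{\gamma\in\mathcal{T}_0^o}[\gamma]\,\mathfrak{I}^{\mathbf{r}}_{m,m'}(\gamma),\qquad [\tau]p\mapsto[\gamma_2]p-[\gamma_1]p$$ for $\tau$ oriented from $\gamma_1$ to $\gamma_2$, where $[\gamma]=0$ if $\gamma\notin\mathcal{T}_0^o$. Then $h_{m,m'}^{\mathbf{r}}(\mathcal{T})$ is the dimension of the cokernel $H_0(\mathfrak{I}_{m,m'}^{\mathbf{r}}(\mathcal{T}^o))$ of $\partial_1$. Maximal interior segments and weights. For an interior edge $\tau$, the maximal segment $\rho(\tau)$ is the maximal connected union of interior edges of the same direction as $\tau$ that contains $\tau$. It is interior if it does not intersect $\partial\Omega$. $\mathrm{MIS}(\mathcal{T})$, $\mathrm{MIS}_h(\mathcal{T})$, $\mathrm{MIS}_v(\mathcal{T})$ are the sets of all, horizontal, vertical maximal interior segments. $\mathbf{r}(\rho)=\mathbf{r}(\tau)$ for any edge $\tau\subset\rho$. An ordering $\iota$ of $\mathrm{MIS}(\mathcal{T})$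 is a map from $\mathrm{MIS}(\mathcal{T})$ to $\mathbb{N}$. $\Gamma_\iota(\rho)$ is the set of vertices of $\rho$ which do not lie on a maximal interior segment $\rho'$ with $\iota(\rho')>\iota(\rho)$. The weight of $\rho$ is $\omega_\iota(\rho)=\sum_{\gamma\in\Gamma_\iota(\rho)}(m-\mathbf{r}_h(\gamma))$ if $\rho\in\mathrm{MIS}_h(\mathcal{T})$ and $\omega_\iota(\rho)=\sum_{\gamma\in\Gamma_\iota(\rho)}(m'-\mathbf{r}_v(\gamma))$ if $\rho\in\mathrm{MIS}_v(\mathcal{T})$.
   Formalization: The ordering ι is required to be injective (the bound fails for constant ι), and the factors m'−r(ρ), m−r(ρ) are replaced by their positive parts (otherwise the bound can be negative when r(ρ) exceeds the degree). *)

theory Defs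
  imports "HOL-Analysis.Analysis" "HOL-Computational_Algebra.Polynomial"
begin

type_synonym pt = "real \<times> real"

record tmesh =
  cells :: "pt set set"
  edges :: "pt set set"

definition is_cell :: "pt set \<Rightarrow> bool" where
  "is_cell \<sigma> \<longleftrightarrow> (\<exists>a b c d. a < b \<and> c < d \<and> \<sigma> = {a..b} \<times> {c..d})"

definition is_hseg :: "pt set \<Rightarrow> bool" where
  "is_hseg \<tau> \<longleftrightarrow> (\<exists>a b c. a < b \<and> \<tau> = {a..b} \<times> {c})"

definition is_vseg :: "pt set \<Rightarrow> bool" where
  "is_vseg \<tau> \<longleftrightarrow> (\<exists>a b c. a < b \<and> \<tau> = {c} \<times> {a..b})"

text \<open>The lower/left and the upper/right end point of a segment. They also fix the orientation
  of the edges: from left to right and from bottom to top.\<close>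

definition seg_start :: "pt set \<Rightarrow> pt" where
  "seg_start \<tau> = (Inf (fst ` \<tau>), Inf (snd ` \<tau>))"

definition seg_end :: "pt set \<Rightarrow> pt" where
  "seg_end \<tau> = (Sup (fst ` \<tau>), Sup (snd ` \<tau>))"

lemma seg_ends_h:
  assumes "a < b"
  shows "seg_start ({a..b} \<times> {c}) = (a, c)" "seg_end ({a..b} \<times> {c}) = (b, c)"
  using assms by (auto simp: seg_start_def seg_end_def fst_image_times snd_image_times)

lemma seg_ends_v:
  assumes "a < b"
  shows "seg_start ({c} \<times> {a..b}) = (c, a)" "seg_end ({c} \<times> {a..b}) = (c, b)"
  using assms by (auto simp: seg_start_def seg_end_def fst_image_times snd_image_times)

definition seg_ends :: "pt set \<Rightarrow> pt set" where
  "seg_ends \<tau> = {seg_start \<tau>, seg_end \<tau>}"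

definition vertices :: "tmesh \<Rightarrow> pt set" where
  "vertices T = (\<Union>\<tau>\<in>edges T. seg_ends \<tau>)"

definition domain_of :: "tmesh \<Rightarrow> pt set" where
  "domain_of T = \<Union>(cells T)"

definition hedges :: "tmesh \<Rightarrow> pt set set" where
  "hedges T = {\<tau> \<in> edges T. is_hseg \<tau>}"

definition vedges :: "tmesh \<Rightarrow> pt set set" where
  "vedges T = {\<tau> \<in> edges T. is_vseg \<tau>}"

text \<open>The last three conditions are the standing assumptions on T-meshes.\<close>

definition is_tmesh :: "tmesh \<Rightarrow> bool" where
  "is_tmesh T \<longleftrightarrow>
     finite (cells T) \<and> (\<forall>\<sigma>\<in>cells T. is_cell \<sigma>) \<and>
     finite (edges T) \<and> (\<forall>\<tau>\<in>edges T. is_hseg \<tau> \<or> is_vseg \<tau>) \<and>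
     (\<forall>\<tau>\<in>edges T. \<tau> \<subseteq> (\<Union>\<sigma>\<in>cells T. frontier \<sigma>)) \<and>
     (\<forall>\<sigma>\<in>cells T. \<exists>E. finite E \<and> E \<subseteq> edges T \<and> frontier \<sigma> = \<Union>E) \<and>
     (\<forall>\<sigma>\<in>cells T. \<forall>\<sigma>'\<in>cells T. \<sigma> \<noteq> \<sigma>' \<longrightarrow>
        \<sigma> \<inter> \<sigma>' = frontier \<sigma> \<inter> frontier \<sigma>' \<and>
        (\<exists>E. finite E \<and> E \<subseteq> edges T \<union> (\<lambda>\<gamma>. {\<gamma>}) ` vertices T \<and> \<sigma> \<inter> \<sigma>' = \<Union>E)) \<and>
     (\<forall>\<tau>\<in>edges T. \<forall>\<tau>'\<in>edges T. \<tau> \<noteq> \<tau>' \<longrightarrow>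
        \<tau> \<inter> \<tau>' = seg_ends \<tau> \<inter> seg_ends \<tau>' \<and> \<tau> \<inter> \<tau>' \<subseteq> vertices T) \<and>
     (\<forall>\<gamma>\<in>vertices T. (\<exists>\<tau>\<in>hedges T. \<gamma> \<in> \<tau>) \<and> (\<exists>\<tau>\<in>vedges T. \<gamma> \<in> \<tau>)) \<and>
     simply_connected (domain_of T) \<and>
     connected (interior (domain_of T))"

definition int_edges :: "tmesh \<Rightarrow> pt set set" where
  "int_edges T = {\<tau> \<in> edges T. \<tau> \<inter> interior (domain_of T) \<noteq> {}}"

definition int_vertices :: "tmesh \<Rightarrow> pt set" where
  "int_vertices T = vertices T \<inter> interior (domain_of T)"

text \<open>A smoothness distribution is a pair of maps \<open>rh rv :: real \<Rightarrow> nat\<close>; only the values of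
  \<open>rh\<close> at first coordinates of vertical edges and of \<open>rv\<close> at second coordinates of
  horizontal edges are ever used.\<close>

definition hlevel :: "pt set \<Rightarrow> real" where
  "hlevel \<tau> = (THE b. snd ` \<tau> = {b})"

definition vlevel :: "pt set \<Rightarrow> real" where
  "vlevel \<tau> = (THE a. fst ` \<tau> = {a})"

lemma hlevel_seg: "a < b \<Longrightarrow> hlevel ({a..b} \<times> {c}) = c"
  by (auto simp: hlevel_def snd_image_times)

lemma vlevel_seg: "a < b \<Longrightarrow> vlevel ({c} \<times> {a..b}) = c"
  by (auto simp: vlevel_def fst_image_times)

definition smoothness :: "(real \<Rightarrow> nat) \<Rightarrow> (real \<Rightarrow> nat) \<Rightarrow> pt set \<Rightarrow> nat" where
  "smoothness rh rv \<tau> = (if is_hseg \<tau> then rv (hlevel \<tau>) else rh (vlevel \<tau>))"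

text \<open>A polynomial in \<open>s\<close> and \<open>t\<close> is a polynomial in \<open>t\<close> with coefficients in \<open>\<real>[s]\<close>:
  \<open>[:0, 1:]\<close> is \<open>t\<close> and \<open>[:[:0, 1:]:]\<close> is \<open>s\<close>.\<close>

type_synonym bipoly = "real poly poly"

definition R_space :: "nat \<Rightarrow> nat \<Rightarrow> bipoly set" where
  "R_space m m' = {p. degree p \<le> m' \<and> (\<forall>i. degree (coeff p i) \<le> m)}"

text \<open>\<open>t - b\<close> for a horizontal edge on \<open>t = b\<close>, \<open>s - a\<close> for a vertical edge on \<open>s = a\<close>.\<close>

definition line_poly :: "pt set \<Rightarrow> bipoly" where
  "line_poly \<tau> = (if is_hseg \<tau> then [:[:- hlevel \<tau>:], 1:] else [:[:- vlevel \<tau>, 1:]:])"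

definition Delta :: "(real \<Rightarrow> nat) \<Rightarrow> (real \<Rightarrow> nat) \<Rightarrow> pt set \<Rightarrow> bipoly" where
  "Delta rh rv \<tau> = line_poly \<tau> ^ (smoothness rh rv \<tau> + 1)"

definition edge_ideal ::
  "(real \<Rightarrow> nat) \<Rightarrow> (real \<Rightarrow> nat) \<Rightarrow> nat \<Rightarrow> nat \<Rightarrow> pt set \<Rightarrow> bipoly set" where
  "edge_ideal rh rv m m' \<tau> = {p. Delta rh rv \<tau> dvd p} \<inter> R_space m m'"

text \<open>In a T-mesh the summands do not depend on the choice of the two edges, so ranging over all
  choices gives the sum of the two spaces.\<close>

definition vertex_ideal ::
  "tmesh \<Rightarrow> (real \<Rightarrow> nat) \<Rightarrow> (real \<Rightarrow> nat) \<Rightarrow> nat \<Rightarrow> nat \<Rightarrow> pt \<Rightarrow> bipoly set" where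
  "vertex_ideal T rh rv m m' \<gamma> =
     {p + q | p q \<tau>v \<tau>h. \<tau>v \<in> vedges T \<and> \<gamma> \<in> \<tau>v \<and> \<tau>h \<in> hedges T \<and> \<gamma> \<in> \<tau>h \<and>
        p \<in> edge_ideal rh rv m m' \<tau>v \<and> q \<in> edge_ideal rh rv m m' \<tau>h}"

definition direct_sum :: "'i set \<Rightarrow> ('i \<Rightarrow> bipoly set) \<Rightarrow> ('i \<Rightarrow> bipoly) set" where
  "direct_sum I A = {f. (\<forall>i\<in>I. f i \<in> A i) \<and> (\<forall>i. i \<notin> I \<longrightarrow> f i = 0)}"

definition boundary1 :: "tmesh \<Rightarrow> (pt set \<Rightarrow> bipoly) \<Rightarrow> (pt \<Rightarrow> bipoly)" where
  "boundary1 T f = (\<lambda>\<gamma>. if \<gamma> \<in> int_vertices T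
     then (\<Sum>\<tau>\<in>int_edges T. (if seg_end \<tau> = \<gamma> then f \<tau> else 0) -
                             (if seg_start \<tau> = \<gamma> then f \<tau> else 0))
     else 0)"

definition lincomb :: "(('i \<Rightarrow> bipoly) \<Rightarrow> real) \<Rightarrow> ('i \<Rightarrow> bipoly) set \<Rightarrow> 'i \<Rightarrow> bipoly" where
  "lincomb c B = (\<lambda>i. \<Sum>b\<in>B. smult [:c b:] (b i))"

text \<open>\<open>B\<close> is a finite subset of \<open>V\<close> whose classes form a basis of the real vector space \<open>V / W\<close>.\<close>

definition quotient_basis ::
  "('i \<Rightarrow> bipoly) set \<Rightarrow> ('i \<Rightarrow> bipoly) set \<Rightarrow> ('i \<Rightarrow> bipoly) set \<Rightarrow> bool" where
  "quotient_basis V W B \<longleftrightarrow>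
     finite B \<and> B \<subseteq> V \<and>
     (\<forall>c. lincomb c B \<in> W \<longrightarrow> (\<forall>b\<in>B. c b = 0)) \<and>
     (\<forall>v\<in>V. \<exists>c. (\<lambda>i. v i - lincomb c B i) \<in> W)"

text \<open>As for the library's dimension of a vector space, the value is 0 if there is no finite
  basis; the quotient considered below is finite-dimensional.\<close>

definition quotient_dim :: "('i \<Rightarrow> bipoly) set \<Rightarrow> ('i \<Rightarrow> bipoly) set \<Rightarrow> nat" where
  "quotient_dim V W =
     (if \<exists>B. quotient_basis V W B then card (SOME B. quotient_basis V W B) else 0)"

definition h_dim :: "tmesh \<Rightarrow> (real \<Rightarrow> nat) \<Rightarrow> (real \<Rightarrow> nat) \<Rightarrow> nat \<Rightarrow> nat \<Rightarrow> nat" where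
  "h_dim T rh rv m m' = quotient_dim
     (direct_sum (int_vertices T) (vertex_ideal T rh rv m m'))
     (boundary1 T ` direct_sum (int_edges T) (edge_ideal rh rv m m'))"

text \<open>The connected unions of edges from \<open>D\<close> that contain \<open>\<tau>\<close>, where \<open>D\<close> will be the set of all
  interior edges of one direction.\<close>

definition connected_unions :: "pt set set \<Rightarrow> pt set \<Rightarrow> pt set set" where
  "connected_unions D \<tau> = {\<Union>E | E. E \<subseteq> D \<and> \<tau> \<in> E \<and> connected (\<Union>E)}"

definition is_maximal_segment :: "pt set set \<Rightarrow> pt set \<Rightarrow> pt set \<Rightarrow> bool" where
  "is_maximal_segment D \<tau> \<rho> \<longleftrightarrow>
     \<rho> \<in> connected_unions D \<tau> \<and> (\<forall>\<rho>'\<in>connected_unions D \<tau>. \<rho> \<subseteq> \<rho>' \<longrightarrow> \<rho>' = \<rho>)"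

definition MIS_h :: "tmesh \<Rightarrow> pt set set" where
  "MIS_h T = {\<rho>. (\<exists>\<tau> \<in> int_edges T \<inter> hedges T. is_maximal_segment (int_edges T \<inter> hedges T) \<tau> \<rho>) \<and>
                 \<rho> \<inter> frontier (domain_of T) = {}}"

definition MIS_v :: "tmesh \<Rightarrow> pt set set" where
  "MIS_v T = {\<rho>. (\<exists>\<tau> \<in> int_edges T \<inter> vedges T. is_maximal_segment (int_edges T \<inter> vedges T) \<tau> \<rho>) \<and>
                 \<rho> \<inter> frontier (domain_of T) = {}}"

definition MIS :: "tmesh \<Rightarrow> pt set set" where
  "MIS T = MIS_h T \<union> MIS_v T"

definition seg_smoothness :: "tmesh \<Rightarrow> (real \<Rightarrow> nat) \<Rightarrow> (real \<Rightarrow> nat) \<Rightarrow> pt set \<Rightarrow> nat" where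
  "seg_smoothness T rh rv \<rho> = (THE k. \<exists>\<tau>\<in>edges T. \<tau> \<subseteq> \<rho> \<and> smoothness rh rv \<tau> = k)"

text \<open>An ordering numbers the maximal interior segments, so distinct segments get distinct
  numbers.\<close>

definition is_ordering :: "tmesh \<Rightarrow> (pt set \<Rightarrow> nat) \<Rightarrow> bool" where
  "is_ordering T \<iota> \<longleftrightarrow> inj_on \<iota> (MIS T)"

definition Gamma_ord :: "tmesh \<Rightarrow> (pt set \<Rightarrow> nat) \<Rightarrow> pt set \<Rightarrow> pt set" where
  "Gamma_ord T \<iota> \<rho> =
     {\<gamma> \<in> vertices T. \<gamma> \<in> \<rho> \<and> \<not> (\<exists>\<rho>'\<in>MIS T. \<gamma> \<in> \<rho>' \<and> \<iota> \<rho>' > \<iota> \<rho>)}"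

definition weight :: "tmesh \<Rightarrow> (real \<Rightarrow> nat) \<Rightarrow> (real \<Rightarrow> nat) \<Rightarrow> nat \<Rightarrow> nat \<Rightarrow>
    (pt set \<Rightarrow> nat) \<Rightarrow> pt set \<Rightarrow> int" where
  "weight T rh rv m m' \<iota> \<rho> =
     (if \<rho> \<in> MIS_h T then \<Sum>\<gamma>\<in>Gamma_ord T \<iota> \<rho>. int m - int (rh (fst \<gamma>))
      else \<Sum>\<gamma>\<in>Gamma_ord T \<iota> \<rho>. int m' - int (rv (snd \<gamma>)))"

end

theory Submission
  imports Defs "HOL-Library.Function_Algebras"
begin

text \<open>Modulo the image of \<open>\<partial>\<^sub>1\<close>, an element \<open>[\<gamma>] p\<close> with \<open>p\<close> in the ideal of a segment \<open>\<rho>\<close>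
  through \<open>\<gamma>\<close> may be moved to any other vertex of \<open>\<rho>\<close>, and it vanishes if \<open>\<rho>\<close> reaches the
  boundary. So the cokernel is generated by classes \<open>[\<rho>] p\<close> for the maximal interior segments
  \<open>\<rho>\<close>. Filter it by the ordering \<open>\<iota>\<close>. For \<open>\<rho>\<close> horizontal on \<open>t = b\<close> and a vertex
  \<open>(a, b) \<in> \<Gamma>(\<rho>)\<close>, polynomials that are also divisible by \<open>(s - a)\<^bsup>r\<^sub>h(a) + 1\<^esup>\<close> can be moved to the
  transversal segment, which is earlier. The graded piece of \<open>\<rho>\<close> is therefore generated by
  \<open>m' - r(\<rho>)\<close> copies of the quotient of the polynomials in \<open>s\<close> of degree at most \<open>m\<close> by the
  sum of the multiples of \<open>(s - a)\<^bsup>r\<^sub>h(a) + 1\<^esup>\<close>, a quotient of dimension at most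
  \<open>(m + 1 - \<Sum> (m - r\<^sub>h(a))\<^sub>+)\<^sub>+\<close>.\<close>

section \<open>Polynomials spanned by powers of linear forms\<close>

interpretation rp: vector_space "smult :: real \<Rightarrow> real poly \<Rightarrow> real poly"
  by unfold_locales (auto simp: smult_add_right smult_add_left)

text \<open>Induction on \<open>m\<close> through the polar derivative \<open>m f - (s - a\<^sub>0) f'\<close>, which lowers the degree
  bound by one and \<open>d a\<^sub>0\<close> by one, keeps the other \<open>d a\<close>, and has kernel spanned by \<open>(s - a\<^sub>0)\<^bsup>m\<^esup>\<close>.\<close>
lemma polar_span:
  fixes d :: "real \<Rightarrow> nat"
  assumes "finite A" "m < sum d A" "degree f \<le> m"
  shows "f \<in> rp.span {[:-a, 1:] ^ k | a k. a \<in> A \<and> k \<le> m \<and> m < k + d a}"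
  using assms(2,3)
proof (induction m arbitrary: d f)
  case 0
  then obtain a where a: "a \<in> A" "d a > 0"
    by (metis gr_zeroI sum.neutral less_numeral_extra(3))
  obtain c where c: "f = [:c:]" using 0 by (metis degree_eq_zeroE le_zero_eq)
  have "smult c 1 \<in> rp.span {[:-a, 1:] ^ k | a k. a \<in> A \<and> k \<le> 0 \<and> 0 < k + d a}"
    using a by (intro rp.span_scale rp.span_base) force
  then show ?case using c by simp
next
  case (Suc m)
  obtain a0 where a0: "a0 \<in> A" "d a0 > 0"
    using Suc.prems by (metis gr_zeroI sum.neutral not_less_zero)
  define L where "L g = smult (real (Suc m)) g - [:-a0, 1:] * pderiv g" for g :: "real poly"
  have L_add: "L (p + q) = L p + L q" for p q
    by (simp add: L_def pderiv_add smult_add_right algebra_simps)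
  have L_smult: "L (smult c p) = smult c (L p)" for p c
    by (simp add: L_def pderiv_smult smult_diff_right smult_add_right mult.commute)
  have L_diff: "L (p - q) = L p - L q" for p q
    by (simp add: L_def pderiv_diff smult_diff_right algebra_simps)
  define d' where "d' = d(a0 := d a0 - 1)"
  have "sum d A = Suc (sum d' A)"
  proof -
    have "sum d (A - {a0}) = sum d' (A - {a0})"
      by (rule sum.cong) (auto simp: d'_def)
    then show ?thesis
      using sum.remove[OF assms(1) a0(1), of d] sum.remove[OF assms(1) a0(1), of d'] a0(2)
      by (simp add: d'_def)
  qed
  then have d'_sum: "m < sum d' A" using Suc.prems by simp
  have coeff_L: "coeff (L g) i = (real (Suc m) - real i) * coeff g i + a0 * real (Suc i) * coeff g (Suc i)"
    for g i
    by (cases i) (simp_all add: L_def coeff_pderiv algebra_simps)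
  \<comment> \<open>At \<open>i = Suc m\<close> the factor \<open>Suc m - i\<close> removes the top
    coefficient, and the other term involves a coefficient beyond the degree of
    \<open>f\<close>.\<close>
  have degL: "degree (L f) \<le> m"
  proof (rule degree_le, intro allI impI)
    fix i assume "m < i"
    then show "coeff (L f) i = 0"
      using Suc.prems(2) by (cases "i = Suc m") (auto simp: coeff_L coeff_eq_0)
  qed
  define S where "S = {[:-a, 1:] ^ k | a k. a \<in> A \<and> k \<le> Suc m \<and> Suc m < k + d a}"
  have S_I: "[:-a, 1:] ^ k \<in> S" if "a \<in> A" "k \<le> Suc m" "Suc m < k + d a" for a k
    unfolding S_def using that by blast
  \<comment> \<open>\<open>P\<close> is the image of \<open>rp.span S\<close> under
    \<open>L\<close>. Once it contains the generators for \<open>m\<close> and \<open>d'\<close>,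
    the induction hypothesis places \<open>L f\<close> in it.\<close>
  define P where "P = {u. \<exists>v\<in>rp.span S. L v = u}"
  have P_sub: "rp.subspace P"
  proof (rule rp.subspaceI)
    show "0 \<in> P" unfolding P_def by (auto intro!: bexI[of _ "0::real poly"] simp: L_def rp.span_zero)
  next
    fix x y assume "x \<in> P" "y \<in> P"
    then show "x + y \<in> P" unfolding P_def using L_add rp.span_add by blast
  next
    fix c x assume "x \<in> P"
    then show "smult c x \<in> P" unfolding P_def using L_smult rp.span_scale by blast
  qed
  have P_cancel: "p \<in> P" if "smult c p \<in> P" "c \<noteq> 0" for c p
    using rp.subspace_scale[OF P_sub that(1), of "inverse c"] that(2) by simp
  have Lpow: "L ([:-a, 1:] ^ Suc j) =
      smult (real m - real j) ([:-a, 1:] ^ Suc j) - smult (real (Suc j) * (a - a0)) ([:-a, 1:] ^ j)" for a j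
  proof -
    have e: "pderiv ([:-a, 1:] ^ Suc j) = smult (real (Suc j)) ([:-a, 1:] ^ j)"
      by (simp only: pderiv_power_Suc) (simp add: pderiv_pCons)
    have "[:-a0, 1:] = [:-a, 1:] + [:a - a0:]" by simp
    then have "[:-a0, 1:] * pderiv ([:-a, 1:] ^ Suc j) =
       smult (real (Suc j)) ([:-a, 1:] ^ Suc j) + smult (real (Suc j) * (a - a0)) ([:-a, 1:] ^ j)"
      unfolding e by (simp add: algebra_simps)
    moreover have "smult (real (Suc m)) p = smult (real m - real j) p + smult (real (Suc j)) p" for p :: "real poly"
      by (simp flip: smult_add_left)
    ultimately show ?thesis unfolding L_def by simp
  qed
  have gen: "[:-a, 1:] ^ j \<in> P" if "a \<in> A" "j \<le> m" "m < j + d' a" for a j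
  proof (cases "a = a0")
    case True
    \<comment> \<open>Powers at the pole \<open>a0\<close> are eigenvectors of \<open>L\<close>; the
      eigenvalue \<open>Suc m - j\<close> is nonzero because \<open>j \<le> m\<close>.\<close>
    have "L ([:-a0, 1:] ^ j) = smult (real (Suc m) - real j) ([:-a0, 1:] ^ j)"
    proof (cases j)
      case 0
      then show ?thesis by (simp add: L_def)
    next
      case (Suc i)
      have "real (Suc m) - real j = real m - real i" using Suc by simp
      then show ?thesis
        unfolding Suc Lpow by (simp only: diff_self mult_zero_right smult_0_left diff_zero)
    qed
    moreover have "[:-a0, 1:] ^ j \<in> S"
      using that a0 True by (intro S_I) (auto simp: d'_def)
    ultimately have "smult (real (Suc m) - real j) ([:-a0, 1:] ^ j) \<in> P"
      unfolding P_def using rp.span_base by blast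
    then show ?thesis using True that by (auto dest: P_cancel)
  next
    case False
    have da: "d' a = d a" using False by (simp add: d'_def)
    \<comment> \<open>Solve \<open>Lpow\<close> for the lower power, whose coefficient is nonzero
      since \<open>a \<noteq> a0\<close>. The descent over exponents starts at \<open>m\<close>,
      where the coefficient \<open>m - i\<close> of the higher power vanishes.\<close>
    have down: "[:-a, 1:] ^ i \<in> P"
      if "i \<le> m" "m < i + d a" "smult (real m - real i) ([:-a, 1:] ^ Suc i) \<in> P" for i
    proof -
      have "[:-a, 1:] ^ Suc i \<in> S" using that \<open>a \<in> A\<close> by (intro S_I) auto
      then have "L ([:-a, 1:] ^ Suc i) \<in> P" unfolding P_def using rp.span_base by blast
      with that(3) have "smult (real m - real i) ([:-a, 1:] ^ Suc i) - L ([:-a, 1:] ^ Suc i) \<in> P"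
        by (rule rp.subspace_diff[OF P_sub])
      then have "smult (real (Suc i) * (a - a0)) ([:-a, 1:] ^ i) \<in> P"
        unfolding Lpow by (simp only: diff_diff_eq2 add_diff_cancel_left')
      then show ?thesis by (rule P_cancel) (use False in simp)
    qed
    from that(2) show ?thesis using that(3) unfolding da
    proof (induction j rule: inc_induct)
      case base
      have "smult (real m - real m) ([:-a, 1:] ^ Suc m) \<in> P"
        by (simp only: diff_self smult_0_left rp.subspace_0[OF P_sub])
      then show ?case using base by (intro down) auto
    next
      case (step j)
      then have "[:-a, 1:] ^ Suc j \<in> P" by (intro step.IH) simp
      then have "smult (real m - real j) ([:-a, 1:] ^ Suc j) \<in> P"
        by (rule rp.subspace_scale[OF P_sub])
      then show ?case using step.hyps step.prems by (intro down) auto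
    qed
  qed
  have "L f \<in> rp.span {[:-a, 1:] ^ k | a k. a \<in> A \<and> k \<le> m \<and> m < k + d' a}"
    using Suc.IH d'_sum degL by blast
  also have "\<dots> \<subseteq> P" using gen by (intro rp.span_minimal P_sub) auto
  finally obtain v where v: "v \<in> rp.span S" "L v = L f" unfolding P_def by auto
  have degS: "degree v \<le> Suc m"
  proof -
    have "rp.subspace {p. degree p \<le> Suc m}"
      unfolding rp.subspace_def by (auto intro: degree_add_le order_trans[OF degree_smult_le])
    moreover have "S \<subseteq> {p. degree p \<le> Suc m}"
      unfolding S_def by (auto simp: degree_linear_power)
    ultimately show ?thesis using v(1) rp.span_minimal by blast
  qed
  \<comment> \<open>Both \<open>f - v\<close> and the power of degree \<open>m + 1\<close> at
    \<open>a0\<close> are killed by \<open>L\<close>, so the top coefficient can be removed inside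
    the kernel. On degree \<open>i \<le> m\<close>, however, \<open>L\<close> multiplies the leading
    coefficient by \<open>Suc m - i\<close>, which is not 0.\<close>
  define g where "g = f - v - smult (coeff (f - v) (Suc m)) ([:-a0, 1:] ^ Suc m)"
  have top: "coeff ([:-a0, 1:] ^ Suc m) (Suc m) = 1"
    by (rule coeff_linear_power)
  have "L ([:-a0, 1:] ^ Suc m) = 0" unfolding Lpow by simp
  then have Lg: "L g = 0" unfolding g_def L_diff L_smult using v(2) by simp
  have "g = 0"
  proof (rule ccontr)
    assume "g \<noteq> 0"
    then have "coeff g (degree g) \<noteq> 0" by simp
    moreover have "degree g \<le> Suc m"
      unfolding g_def using Suc.prems(2) degS
      by (intro degree_diff_le order_trans[OF degree_smult_le]) (simp_all only: degree_linear_power)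
    moreover have "coeff g (Suc m) = 0" unfolding g_def coeff_diff coeff_smult top by simp
    ultimately have "degree g < Suc m" by (metis le_neq_implies_less)
    moreover have "coeff (L g) (degree g) = (real (Suc m) - real (degree g)) * coeff g (degree g)"
      unfolding coeff_L by (simp add: coeff_eq_0)
    ultimately show False using Lg \<open>coeff g (degree g) \<noteq> 0\<close> by simp
  qed
  then have "f = v + smult (coeff (f - v) (Suc m)) ([:-a0, 1:] ^ Suc m)"
    unfolding g_def by (simp add: algebra_simps)
  moreover have "[:-a0, 1:] ^ Suc m \<in> S" using a0 by (intro S_I) auto
  ultimately have "f \<in> rp.span S"
    using v(1) rp.span_add rp.span_scale rp.span_base by metis
  then show ?case unfolding S_def .
qed

text \<open>If \<open>\<Sum>d \<le> m\<close>, the complement is spanned by powers at one additional point.\<close>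
lemma polar_complement:
  fixes d :: "real \<Rightarrow> nat"
  assumes "finite A"
  obtains Q where "finite Q" "card Q \<le> m + 1 - sum d A"
    "\<And>f. degree f \<le> m \<Longrightarrow> f \<in> rp.span (Q \<union> {[:-a, 1:] ^ k | a k. a \<in> A \<and> k \<le> m \<and> m < k + d a})"
proof -
  obtain b where b: "b \<notin> A" using ex_new_if_finite[OF infinite_UNIV_char_0 assms] by blast
  define e where "e = m + 1 - sum d A"
  define Q where "Q = (\<lambda>k. [:-b, 1:] ^ k) ` {m + 1 - e..<m + 1}"
  define d' where "d' = d(b := e)"
  have "sum d' A = sum d A" unfolding d'_def using b by (intro sum.cong) auto
  then have "sum d' (insert b A) = e + sum d A" using assms b by (simp add: d'_def)
  then have "m < sum d' (insert b A)" by (simp add: e_def)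
  note sp = polar_span[OF finite.insertI[OF assms] this]
  have sub: "{[:-a, 1:] ^ k | a k. a \<in> insert b A \<and> k \<le> m \<and> m < k + d' a} \<subseteq>
      Q \<union> {[:-a, 1:] ^ k | a k. a \<in> A \<and> k \<le> m \<and> m < k + d a}"
  proof
    fix x assume "x \<in> {[:-a, 1:] ^ k | a k. a \<in> insert b A \<and> k \<le> m \<and> m < k + d' a}"
    then obtain a k where x: "x = [:-a, 1:] ^ k" and ak: "a \<in> insert b A" "k \<le> m" "m < k + d' a"
      by blast
    show "x \<in> Q \<union> {[:-a, 1:] ^ k | a k. a \<in> A \<and> k \<le> m \<and> m < k + d a}"
    proof (cases "a = b")
      case True
      then have "k \<in> {m + 1 - e..<m + 1}" using ak by (simp add: d'_def)
      then show ?thesis unfolding x True Q_def by blast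
    next
      case False
      then show ?thesis using ak x by (auto simp: d'_def)
    qed
  qed
  have "card Q \<le> e" unfolding Q_def by (rule order_trans[OF card_image_le]) auto
  moreover have "finite Q" by (simp add: Q_def)
  ultimately show ?thesis
    using sp rp.span_mono[OF sub] that[of Q] unfolding e_def by blast
qed

section \<open>Dimension of a quotient\<close>

text \<open>Real scalars act through constant polynomials, since \<open>smult\<close> on
  \<open>bipoly\<close> scales by elements of the coefficient ring in \<open>s\<close>. With this
  action \<open>lincomb\<close> is an ordinary linear combination.\<close>

definition fscale :: "real \<Rightarrow> ('i \<Rightarrow> bipoly) \<Rightarrow> 'i \<Rightarrow> bipoly" where
  "fscale c f = (\<lambda>i. smult [:c:] (f i))"

interpretation fs: vector_space "fscale :: real \<Rightarrow> ('i \<Rightarrow> bipoly) \<Rightarrow> 'i \<Rightarrow> bipoly"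
proof
  fix a b :: real and x y :: "'i \<Rightarrow> bipoly"
  show "fscale a (x + y) = fscale a x + fscale a y"
    by (simp add: fscale_def fun_eq_iff smult_add_right)
  have "[:a + b:] = [:a:] + [:b:]" by simp
  then show "fscale (a + b) x = fscale a x + fscale b x"
    by (simp only: fscale_def fun_eq_iff plus_fun_def smult_add_left) simp
  have "[:a * b:] = [:a:] * [:b:]" by simp
  then show "fscale a (fscale b x) = fscale (a * b) x"
    by (simp only: fscale_def fun_eq_iff smult_smult) simp
  show "fscale 1 x = x"
    by (simp add: fscale_def fun_eq_iff flip: one_pCons)
qed

lemma lincomb_eq_sum: "lincomb c B = (\<Sum>b\<in>B. fscale (c b) b)"
  by (induction B rule: infinite_finite_induct)
    (simp_all add: lincomb_def fscale_def fun_eq_iff)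

text \<open>Subtracting from each basis element its component in \<open>W\<close> moves it into
  \<open>fs.span S\<close>. The differences remain independent, because a relation among them would
  put a combination of \<open>B\<close> into \<open>W\<close>; the exchange bound then
  applies.\<close>

lemma card_quotient_basis_le:
  assumes W: "fs.subspace W" and S: "finite S" "V \<subseteq> fs.span (W \<union> S)" and B: "quotient_basis V W B"
  shows "card B \<le> card S"
proof -
  have "\<exists>w\<in>W. b - w \<in> fs.span S" if "b \<in> B" for b
  proof -
    have "b \<in> fs.span (W \<union> S)" using that B S unfolding quotient_basis_def by blast
    then obtain w s where "b = w + s" "w \<in> fs.span W" "s \<in> fs.span S"
      unfolding fs.span_Un by auto
    moreover have "fs.span W = W" using W by simp
    ultimately show ?thesis by (intro bexI[of _ w]) auto
  qed
  then obtain w where w: "\<And>b. b \<in> B \<Longrightarrow> w b \<in> W" "\<And>b. b \<in> B \<Longrightarrow> b - w b \<in> fs.span S"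
    by metis
  have fin: "finite B" using B unfolding quotient_basis_def by blast
  have indep: "\<forall>b\<in>B. c b = 0" if "(\<Sum>b\<in>B. fscale (c b) (b - w b)) = 0" for c
  proof -
    have "(\<Sum>b\<in>B. fscale (c b) b) = (\<Sum>b\<in>B. fscale (c b) (w b))"
      using that by (simp add: fs.scale_right_diff_distrib sum_subtractf)
    moreover have "\<dots> \<in> W"
      using w W by (intro fs.subspace_sum fs.subspace_scale) auto
    ultimately have "lincomb c B \<in> W" unfolding lincomb_eq_sum by simp
    then show ?thesis using B unfolding quotient_basis_def by blast
  qed
  let ?f = "\<lambda>b. b - w b"
  have inj: "inj_on ?f B"
  proof (rule inj_onI, rule ccontr)
    fix x y assume xy: "x \<in> B" "y \<in> B" "x - w x = y - w y" "x \<noteq> y"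
    \<comment> \<open>If two differences coincided, their difference would be a nontrivial relation
      with coefficients 1 and -1.\<close>
    define c where "c b = (if b = x then 1 else if b = y then -1 else 0 :: real)" for b
    have "(\<Sum>b\<in>B. fscale (c b) (b - w b)) = (\<Sum>b\<in>{x, y}. fscale (c b) (b - w b))"
      using xy fin by (intro sum.mono_neutral_right) (auto simp: c_def)
    also have "\<dots> = 0" using xy by (simp add: c_def)
    finally have "c x = 0" using indep xy by blast
    then show False by (simp add: c_def)
  qed
  have "fs.independent (?f ` B)"
  proof (rule fs.independent_if_scalars_zero)
    fix c x assume c: "(\<Sum>x\<in>?f ` B. fscale (c x) x) = 0" and x: "x \<in> ?f ` B"
    have "(\<Sum>b\<in>B. fscale (c (?f b)) (b - w b)) = 0"
      using c by (simp add: sum.reindex[OF inj])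
    then show "c x = 0" using indep[of "\<lambda>b. c (?f b)"] x by auto
  qed (use fin in simp)
  then have "card (?f ` B) \<le> card S"
    using fs.independent_span_bound[OF S(1)] w(2) by blast
  then show ?thesis by (simp add: card_image[OF inj])
qed

text \<open>The basis selected by \<open>SOME\<close> obeys the preceding bound; without any basis
  the default value 0 obeys it trivially.\<close>

lemma quotient_dim_le:
  assumes "fs.subspace W" "finite S" "V \<subseteq> fs.span (W \<union> S)"
  shows "quotient_dim V W \<le> card S"
proof (cases "\<exists>B. quotient_basis V W B")
  case True
  then have "quotient_basis V W (SOME B. quotient_basis V W B)" by (rule someI_ex)
  then show ?thesis using card_quotient_basis_le[OF assms] True by (simp add: quotient_dim_def)
qed (simp add: quotient_dim_def)

section \<open>Edges and maximal segments\<close>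

text \<open>Directions are Booleans, \<open>True\<close> being the horizontal one. A segment of direction \<open>d\<close>
  varies in \<open>coord d\<close>, and \<open>coord (\<not> d)\<close> is its level.\<close>
definition coord :: "bool \<Rightarrow> pt \<Rightarrow> real" where
  "coord d x = (if d then fst x else snd x)"

definition is_seg :: "bool \<Rightarrow> pt set \<Rightarrow> bool" where
  "is_seg d \<tau> \<longleftrightarrow> (if d then is_hseg \<tau> else is_vseg \<tau>)"

lemma coord_eqI: "coord d x = coord d y \<Longrightarrow> coord (\<not> d) x = coord (\<not> d) y \<Longrightarrow> x = y"
  by (cases d) (auto simp: coord_def prod_eq_iff)

lemma is_segE:
  assumes "is_seg d \<tau>"
  obtains a b c where "a < b" "\<tau> = {x. a \<le> coord d x \<and> coord d x \<le> b \<and> coord (\<not> d) x = c}"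
    "seg_ends \<tau> = {x. (coord d x = a \<or> coord d x = b) \<and> coord (\<not> d) x = c}"
proof (cases d)
  case True
  then obtain a b c where t: "a < b" "\<tau> = {a..b} \<times> {c}"
    using assms unfolding is_seg_def is_hseg_def by auto
  have "\<tau> = {x. a \<le> coord d x \<and> coord d x \<le> b \<and> coord (\<not> d) x = c}"
    using True t by (auto simp: coord_def)
  moreover have "seg_ends \<tau> = {x. (coord d x = a \<or> coord d x = b) \<and> coord (\<not> d) x = c}"
    using True t by (auto simp: coord_def seg_ends_def seg_ends_h)
  ultimately show ?thesis using t(1) by (intro that[of a b c])
next
  case False
  then obtain a b c where t: "a < b" "\<tau> = {c} \<times> {a..b}"
    using assms unfolding is_seg_def is_vseg_def by auto
  have "\<tau> = {x. a \<le> coord d x \<and> coord d x \<le> b \<and> coord (\<not> d) x = c}"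
    using False t by (auto simp: coord_def)
  moreover have "seg_ends \<tau> = {x. (coord d x = a \<or> coord d x = b) \<and> coord (\<not> d) x = c}"
    using False t by (auto simp: coord_def seg_ends_def seg_ends_v)
  ultimately show ?thesis using t(1) by (intro that[of a b c])
qed

lemma continuous_coord [continuous_intros]: "continuous_on A (coord d)"
  by (cases d) (auto simp: coord_def[abs_def] intro: continuous_intros)

lemma seg_ends_subset: "is_seg d \<tau> \<Longrightarrow> seg_ends \<tau> \<subseteq> \<tau>"
  by (erule is_segE) auto

lemma seg_ends_ne: "seg_ends \<tau> \<noteq> {}"
  by (simp add: seg_ends_def)

lemma seg_connected_compact:
  assumes "is_seg d \<tau>"
  shows "connected \<tau>" "compact \<tau>"
  using assms unfolding is_seg_def is_hseg_def is_vseg_def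
  by (auto split: if_splits intro!: connected_Times compact_Times)

lemma seg_same_level: "is_seg d \<tau> \<Longrightarrow> x \<in> \<tau> \<Longrightarrow> y \<in> \<tau> \<Longrightarrow> coord (\<not> d) x = coord (\<not> d) y"
  by (erule is_segE) auto

text \<open>The end points of a segment of direction \<open>d\<close> differ in
  \<open>coord d\<close>, so only \<open>coord (\<not> d)\<close> can be constant on it.\<close>

lemma seg_direction:
  assumes "is_seg d \<tau>" "\<And>x. x \<in> \<tau> \<Longrightarrow> coord (\<not> e) x = c"
  shows "e = d"
proof (rule ccontr)
  assume "e \<noteq> d"
  then have "e = (\<not> d)" by simp
  obtain a b c' where t: "a < b" "\<tau> = {x. a \<le> coord d x \<and> coord d x \<le> b \<and> coord (\<not> d) x = c'}"
    using assms(1) by (rule is_segE)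
  define pnt where "pnt s = (if d then (s, c') else (c', s))" for s :: real
  have "coord d (pnt s) = s" "coord (\<not> d) (pnt s) = c'" for s by (auto simp: pnt_def coord_def)
  then have "pnt a \<in> \<tau>" "pnt b \<in> \<tau>" using t by auto
  then have "coord d (pnt a) = c" "coord d (pnt b) = c" using assms(2) \<open>e = (\<not> d)\<close> by auto
  then show False using t(1) \<open>\<And>s. coord d (pnt s) = s\<close> by auto
qed

text \<open>A segment is contained in the closure of its relative interior, which every open set
  meeting the segment must therefore meet.\<close>

lemma seg_open_closure:
  assumes "is_seg d \<tau>" "open U" "\<tau> \<inter> U \<noteq> {}"
  shows "(\<tau> - seg_ends \<tau>) \<inter> U \<noteq> {}"
proof -
  have "\<tau> \<subseteq> closure (\<tau> - seg_ends \<tau>)"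
  proof (cases d)
    case True
    then obtain a b c where t: "a < b" "\<tau> = {a..b} \<times> {c}"
      using assms unfolding is_seg_def is_hseg_def by auto
    then have "\<tau> - seg_ends \<tau> = {a<..<b} \<times> {c}" by (auto simp: seg_ends_def seg_ends_h)
    then show ?thesis using t by (simp add: closure_Times)
  next
    case False
    then obtain a b c where t: "a < b" "\<tau> = {c} \<times> {a..b}"
      using assms unfolding is_seg_def is_vseg_def by auto
    then have "\<tau> - seg_ends \<tau> = {c} \<times> {a<..<b}" by (auto simp: seg_ends_def seg_ends_v)
    then show ?thesis using t by (simp add: closure_Times)
  qed
  then show ?thesis using assms(2,3) open_Int_closure_eq_empty[of U "\<tau> - seg_ends \<tau>"] by blast
qed

text \<open>Prepares translations along an edge: only the side in direction \<open>d\<close> is made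
  explicit, the other one stays an arbitrary set \<open>B\<close>.\<close>

lemma cell_coord:
  assumes "is_cell \<sigma>"
  obtains l u B where "\<sigma> = {x. l \<le> coord d x \<and> coord d x \<le> u \<and> coord (\<not> d) x \<in> B}"
proof -
  obtain a b c e where s: "a < b" "c < e" "\<sigma> = {a..b} \<times> {c..e}"
    using assms unfolding is_cell_def by auto
  show ?thesis
  proof (cases d)
    case True
    then show ?thesis using s by (intro that[of a b "{c..e}"]) (auto simp: coord_def)
  next
    case False
    then show ?thesis using s by (intro that[of c e "{a..b}"]) (auto simp: coord_def)
  qed
qed

text \<open>The members with \<open>P\<close> and those without it have closed unions, disjoint by
  \<open>step\<close>. Connectedness leaves one of the two empty. This serves as induction along a
  chain of edges.\<close>

lemma connected_union_chain:
  assumes E: "finite E" "\<And>\<tau>. \<tau> \<in> E \<Longrightarrow> closed \<tau> \<and> \<tau> \<noteq> {}" "connected (\<Union>E)"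
    and P: "\<tau> \<in> E" "P \<tau>"
    and step: "\<And>\<tau> \<tau>'. \<tau> \<in> E \<Longrightarrow> \<tau>' \<in> E \<Longrightarrow> P \<tau> \<Longrightarrow> \<tau> \<inter> \<tau>' \<noteq> {} \<Longrightarrow> P \<tau>'"
    and "\<tau>' \<in> E"
  shows "P \<tau>'"
proof (rule ccontr)
  assume n: "\<not> P \<tau>'"
  define A where "A = \<Union>{\<tau>\<in>E. P \<tau>}"
  define B where "B = \<Union>{\<tau>\<in>E. \<not> P \<tau>}"
  have "closed A" "closed B" unfolding A_def B_def using E by (auto intro!: closed_Union)
  moreover have "A \<inter> B = {}" unfolding A_def B_def using step by blast
  moreover have "\<Union>E = A \<union> B" unfolding A_def B_def by blast
  ultimately have "A \<inter> \<Union>E = {} \<or> B \<inter> \<Union>E = {}"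
    by (intro connected_closedD[OF E(3)]) auto
  moreover have "A \<inter> \<Union>E \<noteq> {}" unfolding A_def using P E(2)[OF P(1)] by blast
  moreover have "B \<inter> \<Union>E \<noteq> {}" unfolding B_def using n \<open>\<tau>' \<in> E\<close> E(2)[OF \<open>\<tau>' \<in> E\<close>] by blast
  ultimately show False by blast
qed

section \<open>Cells, edges and vertices of a T-mesh\<close>

locale mesh =
  fixes T :: tmesh
  assumes is_tmesh: "is_tmesh T"
begin

abbreviation \<Omega> where "\<Omega> \<equiv> domain_of T"

lemma finite_cells: "finite (cells T)"
  and cell: "\<sigma> \<in> cells T \<Longrightarrow> is_cell \<sigma>"
  and finite_edges: "finite (edges T)"
  and edge_seg: "\<tau> \<in> edges T \<Longrightarrow> \<exists>d. is_seg d \<tau>"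
  and edge_frontier: "\<tau> \<in> edges T \<Longrightarrow> x \<in> \<tau> \<Longrightarrow> \<exists>\<sigma>\<in>cells T. x \<in> frontier \<sigma>"
  and cell_frontier: "\<sigma> \<in> cells T \<Longrightarrow> \<exists>E. E \<subseteq> edges T \<and> frontier \<sigma> = \<Union>E"
  and cells_Int: "\<sigma> \<in> cells T \<Longrightarrow> \<sigma>' \<in> cells T \<Longrightarrow> \<sigma> \<noteq> \<sigma>' \<Longrightarrow> \<sigma> \<inter> \<sigma>' = frontier \<sigma> \<inter> frontier \<sigma>'"
  and edges_Int: "\<tau> \<in> edges T \<Longrightarrow> \<tau>' \<in> edges T \<Longrightarrow> \<tau> \<noteq> \<tau>' \<Longrightarrow> \<tau> \<inter> \<tau>' = seg_ends \<tau> \<inter> seg_ends \<tau>'"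
  and vertex_edges: "\<gamma> \<in> vertices T \<Longrightarrow> \<exists>\<tau>\<in>edges T. is_seg d \<tau> \<and> \<gamma> \<in> \<tau>"
proof -
  show "finite (cells T)" "finite (edges T)"
    using is_tmesh unfolding is_tmesh_def by - ((elim conjE, assumption)+)
  have basic: "\<forall>\<sigma>\<in>cells T. is_cell \<sigma>" "\<forall>\<tau>\<in>edges T. is_hseg \<tau> \<or> is_vseg \<tau>"
    and frontier: "\<forall>\<tau>\<in>edges T. \<tau> \<subseteq> (\<Union>\<sigma>\<in>cells T. frontier \<sigma>)"
      "\<forall>\<sigma>\<in>cells T. \<exists>E. finite E \<and> E \<subseteq> edges T \<and> frontier \<sigma> = \<Union>E"
    using is_tmesh unfolding is_tmesh_def by - ((elim conjE, assumption)+)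
  show "is_cell \<sigma>" if "\<sigma> \<in> cells T" using basic(1) that by blast
  show "\<exists>d. is_seg d \<tau>" if "\<tau> \<in> edges T"
    using bspec[OF basic(2) that] is_seg_def[of True] is_seg_def[of False] by auto
  show "\<exists>\<sigma>\<in>cells T. x \<in> frontier \<sigma>" if "\<tau> \<in> edges T" "x \<in> \<tau>"
    using bspec[OF frontier(1) that(1)] that(2) by auto
  show "\<exists>E. E \<subseteq> edges T \<and> frontier \<sigma> = \<Union>E" if "\<sigma> \<in> cells T"
    using bspec[OF frontier(2) that(1)] by auto
  have cells: "\<forall>\<sigma>\<in>cells T. \<forall>\<sigma>'\<in>cells T. \<sigma> \<noteq> \<sigma>' \<longrightarrow>
        \<sigma> \<inter> \<sigma>' = frontier \<sigma> \<inter> frontier \<sigma>' \<and>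
        (\<exists>E. finite E \<and> E \<subseteq> edges T \<union> (\<lambda>\<gamma>. {\<gamma>}) ` vertices T \<and> \<sigma> \<inter> \<sigma>' = \<Union>E)"
    and edges: "\<forall>\<tau>\<in>edges T. \<forall>\<tau>'\<in>edges T. \<tau> \<noteq> \<tau>' \<longrightarrow>
        \<tau> \<inter> \<tau>' = seg_ends \<tau> \<inter> seg_ends \<tau>' \<and> \<tau> \<inter> \<tau>' \<subseteq> vertices T"
    and verts: "\<forall>\<gamma>\<in>vertices T. (\<exists>\<tau>\<in>hedges T. \<gamma> \<in> \<tau>) \<and> (\<exists>\<tau>\<in>vedges T. \<gamma> \<in> \<tau>)"
    using is_tmesh unfolding is_tmesh_def by - ((elim conjE, assumption)+)
  show "\<sigma> \<inter> \<sigma>' = frontier \<sigma> \<inter> frontier \<sigma>'" if "\<sigma> \<in> cells T" "\<sigma>' \<in> cells T" "\<sigma> \<noteq> \<sigma>'"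
    using bspec[OF bspec[OF cells that(1)] that(2)] that(3) by simp
  show "\<tau> \<inter> \<tau>' = seg_ends \<tau> \<inter> seg_ends \<tau>'" if "\<tau> \<in> edges T" "\<tau>' \<in> edges T" "\<tau> \<noteq> \<tau>'"
    using bspec[OF bspec[OF edges that(1)] that(2)] that(3) by simp
  show "\<exists>\<tau>\<in>edges T. is_seg d \<tau> \<and> \<gamma> \<in> \<tau>" if "\<gamma> \<in> vertices T"
    using bspec[OF verts that] by (auto simp: is_seg_def hedges_def vedges_def)
qed

lemma closed_cell: "\<sigma> \<in> cells T \<Longrightarrow> closed \<sigma>"
  using cell unfolding is_cell_def by (auto intro: closed_Times)

lemma closed_domain: "closed \<Omega>"
  unfolding domain_of_def using finite_cells closed_cell by (intro closed_Union) auto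

lemma edge_subset_domain:
  assumes "\<tau> \<in> edges T" shows "\<tau> \<subseteq> \<Omega>"
proof
  fix x assume "x \<in> \<tau>"
  then obtain \<sigma> where "\<sigma> \<in> cells T" "x \<in> frontier \<sigma>" using edge_frontier assms by blast
  then show "x \<in> \<Omega>" using closed_cell frontier_subset_eq unfolding domain_of_def by blast
qed

text \<open>\<open>\<gamma>\<close> is an end of some edge, and distinct edges meet only in common
  ends; so no vertex lies in the relative interior of an edge.\<close>

lemma vertex_on_edge:
  assumes "\<gamma> \<in> vertices T" "\<tau> \<in> edges T" "\<gamma> \<in> \<tau>"
  shows "\<gamma> \<in> seg_ends \<tau>"
proof -
  obtain \<tau>' where \<tau>': "\<tau>' \<in> edges T" "\<gamma> \<in> seg_ends \<tau>'" using assms(1) unfolding vertices_def by auto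
  moreover have "\<gamma> \<in> \<tau>'" using \<tau>' edge_seg seg_ends_subset by blast
  ultimately show ?thesis using edges_Int assms by blast
qed

lemma finite_vertices: "finite (vertices T)"
  unfolding vertices_def seg_ends_def using finite_edges by auto

text \<open>\<open>x\<close> lies on the frontier of some cell, hence on that of
  \<open>\<sigma>\<close> because cells meet only along their frontiers. The frontier is a union of
  edges, and the only edge through a point that is not one of its ends is
  \<open>\<tau>\<close>.\<close>

lemma relint_cell:
  assumes \<tau>: "\<tau> \<in> edges T" "x \<in> \<tau>" "x \<notin> seg_ends \<tau>" and \<sigma>: "\<sigma> \<in> cells T" "x \<in> \<sigma>"
  shows "\<tau> \<subseteq> \<sigma>"
proof -
  have "x \<in> frontier \<sigma>"
  proof -
    obtain \<sigma>' where "\<sigma>' \<in> cells T" "x \<in> frontier \<sigma>'" using edge_frontier \<tau> by blast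
    then show ?thesis
      using cells_Int[OF \<sigma>(1)] \<sigma>(2) closed_cell frontier_subset_eq by (cases "\<sigma>' = \<sigma>") blast+
  qed
  then obtain \<tau>' E where "E \<subseteq> edges T" "frontier \<sigma> = \<Union>E" "\<tau>' \<in> E" "x \<in> \<tau>'"
    using cell_frontier[OF \<sigma>(1)] by blast
  moreover then have "\<tau>' = \<tau>" using edges_Int \<tau> by blast
  ultimately have "\<tau> \<subseteq> frontier \<sigma>" by blast
  then show ?thesis using frontier_subset_eq closed_cell[OF \<sigma>(1)] by blast
qed

text \<open>The cells at a point of the open edge are those containing the edge. They are invariant,
  near the edge, under translation along it, so interior points are carried to interior points.\<close>
lemma int_edge_relint:
  assumes \<tau>: "\<tau> \<in> int_edges T" and y: "y \<in> \<tau>" "y \<notin> seg_ends \<tau>"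
  shows "y \<in> interior \<Omega>"
proof -
  have \<tau>e: "\<tau> \<in> edges T" and "\<tau> \<inter> interior \<Omega> \<noteq> {}" using \<tau> unfolding int_edges_def by auto
  obtain d where d: "is_seg d \<tau>" using edge_seg[OF \<tau>e] by blast
  obtain a b c where t: "a < b" "\<tau> = {x. a \<le> coord d x \<and> coord d x \<le> b \<and> coord (\<not> d) x = c}"
    "seg_ends \<tau> = {x. (coord d x = a \<or> coord d x = b) \<and> coord (\<not> d) x = c}"
    using d by (rule is_segE)
  obtain x where x: "x \<in> \<tau>" "x \<notin> seg_ends \<tau>" "x \<in> interior \<Omega>"
    using seg_open_closure[OF d _ \<open>\<tau> \<inter> interior \<Omega> \<noteq> {}\<close>] by auto
  \<comment> \<open>Removing the finitely many closed cells that miss \<open>x\<close> leaves a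
    neighbourhood of \<open>x\<close> met only by cells through \<open>x\<close>, hence by cells
    containing the whole edge.\<close>
  define U where "U = interior \<Omega> - \<Union>{\<sigma>\<in>cells T. x \<notin> \<sigma>}"
  have "closed (\<Union>{\<sigma>\<in>cells T. x \<notin> \<sigma>})"
    using finite_cells closed_cell by (intro closed_Union) auto
  then have "open U" unfolding U_def by (intro open_Diff open_interior)
  \<comment> \<open>The translation carries \<open>y\<close> to \<open>x\<close>; the second
    condition keeps points within the open range of the edge, where those cells impose no condition
    along \<open>d\<close>.\<close>
  define V where "V = (\<lambda>z. z + (x - y)) -` U \<inter> coord d -` {a<..<b}"
  have "open V" unfolding V_def using \<open>open U\<close>
    by (intro open_Int open_vimage continuous_intros) auto
  have "x \<in> U" unfolding U_def using x by auto
  then have "y \<in> V" unfolding V_def using y t by auto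
  moreover have "V \<subseteq> \<Omega>"
  proof
    fix z assume z: "z \<in> V"
    then have "z + (x - y) \<in> U" unfolding V_def by simp
    then obtain \<sigma> where \<sigma>: "\<sigma> \<in> cells T" "z + (x - y) \<in> \<sigma>" "x \<in> \<sigma>"
      unfolding U_def using interior_subset unfolding domain_of_def by blast
    then have "\<tau> \<subseteq> \<sigma>" using relint_cell \<tau>e x by blast
    obtain l u B where lu: "\<sigma> = {x. l \<le> coord d x \<and> coord d x \<le> u \<and> coord (\<not> d) x \<in> B}"
      using cell_coord[OF cell[OF \<sigma>(1)]] by blast
    define pnt where "pnt s = (if d then (s, c) else (c, s))" for s
    have pnt: "coord d (pnt s) = s" "coord (\<not> d) (pnt s) = c" for s by (auto simp: pnt_def coord_def)
    then have "pnt a \<in> \<sigma>" "pnt b \<in> \<sigma>" using \<open>\<tau> \<subseteq> \<sigma>\<close> t by auto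
    then have "l \<le> a" "b \<le> u" unfolding lu using pnt by auto
    moreover have "a < coord d z" "coord d z < b" using z unfolding V_def by auto
    ultimately have "l \<le> coord d z" "coord d z \<le> u" by auto
    moreover have "coord (\<not> d) (z + (x - y)) = coord (\<not> d) z"
    proof -
      have "coord (\<not> d) x = coord (\<not> d) y" using seg_same_level d x y by blast
      then show ?thesis by (auto simp: coord_def)
    qed
    ultimately have "z \<in> \<sigma>" using \<sigma>(2) unfolding lu by simp
    then show "z \<in> \<Omega>" using \<sigma>(1) unfolding domain_of_def by blast
  qed
  ultimately show ?thesis using \<open>open V\<close> by (meson interior_maximal subsetD)
qed

lemma edge_at_int_vertex: "\<gamma> \<in> int_vertices T \<Longrightarrow> \<tau> \<in> edges T \<Longrightarrow> \<gamma> \<in> \<tau> \<Longrightarrow> \<tau> \<in> int_edges T"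
  unfolding int_vertices_def int_edges_def by blast

section \<open>Maximal segments as connected unions of edges\<close>

definition seg_edges :: "bool \<Rightarrow> pt set set" where
  "seg_edges d = {\<tau> \<in> int_edges T. is_seg d \<tau>}"

definition MISd :: "bool \<Rightarrow> pt set set" where
  "MISd d = (if d then MIS_h T else MIS_v T)"

lemma MISd_eq: "MISd d = {\<rho>. (\<exists>\<tau>\<in>seg_edges d. is_maximal_segment (seg_edges d) \<tau> \<rho>) \<and> \<rho> \<inter> frontier \<Omega> = {}}"
proof -
  have "int_edges T \<inter> hedges T = seg_edges True" "int_edges T \<inter> vedges T = seg_edges False"
    by (auto simp: int_edges_def hedges_def vedges_def seg_edges_def is_seg_def)
  then show ?thesis unfolding MISd_def MIS_h_def MIS_v_def by simp
qed

lemma seg_edges_props: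
  assumes "\<tau> \<in> seg_edges d"
  shows "\<tau> \<in> edges T" "\<tau> \<in> int_edges T" "is_seg d \<tau>" "closed \<tau>" "connected \<tau>" "\<tau> \<noteq> {}"
  using assms seg_connected_compact[of d \<tau>] seg_ends_subset[of d \<tau>] seg_ends_ne[of \<tau>]
  by (auto simp: seg_edges_def int_edges_def compact_imp_closed)

lemma finite_seg_edges: "finite (seg_edges d)"
  using finite_edges by (auto simp: seg_edges_def int_edges_def)

text \<open>There are finitely many unions of edges, and \<open>\<tau>\<close> alone is a connected
  one.\<close>

lemma ex_maximal_segment:
  assumes "\<tau> \<in> seg_edges d"
  shows "\<exists>\<rho>. is_maximal_segment (seg_edges d) \<tau> \<rho>"
proof -
  let ?C = "connected_unions (seg_edges d) \<tau>"
  have "?C \<subseteq> Union ` Pow (seg_edges d)" unfolding connected_unions_def by auto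
  then have "finite ?C" using finite_seg_edges finite_subset by (metis finite_Pow_iff finite_imageI)
  moreover have "\<tau> \<in> ?C"
    unfolding connected_unions_def using assms seg_edges_props[OF assms] by (intro CollectI exI[of _ "{\<tau>}"]) auto
  ultimately obtain \<rho> where "\<rho> \<in> ?C" "\<forall>\<rho>'\<in>?C. \<rho> \<subseteq> \<rho>' \<longrightarrow> \<rho> = \<rho>'"
    using finite_has_maximal[of ?C] by blast
  then show ?thesis unfolding is_maximal_segment_def by blast
qed

lemma maximal_segmentE:
  assumes "is_maximal_segment (seg_edges d) \<tau> \<rho>"
  obtains E where "E \<subseteq> seg_edges d" "\<tau> \<in> E" "\<rho> = \<Union>E" "connected (\<Union>E)"
proof -
  have "\<rho> \<in> connected_unions (seg_edges d) \<tau>" using assms by (simp add: is_maximal_segment_def)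
  then show ?thesis using that by (auto simp: connected_unions_def)
qed

text \<open>Distinct edges that meet share an end point, so a property has to be passed on only
  through common end points.\<close>

lemma seg_edges_chain:
  assumes E: "E \<subseteq> seg_edges d" "connected (\<Union>E)" and P: "\<tau> \<in> E" "P \<tau>"
    and step: "\<And>\<tau> \<tau>' \<delta>. \<tau> \<in> E \<Longrightarrow> \<tau>' \<in> E \<Longrightarrow> P \<tau> \<Longrightarrow> \<delta> \<in> seg_ends \<tau> \<Longrightarrow> \<delta> \<in> seg_ends \<tau>' \<Longrightarrow> P \<tau>'"
    and \<tau>': "\<tau>' \<in> E"
  shows "P \<tau>'"
proof (rule connected_union_chain[of E \<tau> P])
  show "finite E" using E(1) finite_seg_edges by (rule finite_subset)
  show "closed \<tau> \<and> \<tau> \<noteq> {}" if "\<tau> \<in> E" for \<tau> using seg_edges_props(4,6) E(1) that by blast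
  fix \<tau>1 \<tau>2 assume a: "\<tau>1 \<in> E" "\<tau>2 \<in> E" "P \<tau>1" "\<tau>1 \<inter> \<tau>2 \<noteq> {}"
  show "P \<tau>2"
  proof (cases "\<tau>1 = \<tau>2")
    case False
    moreover have "\<tau>1 \<in> edges T" "\<tau>2 \<in> edges T" using a(1,2) E(1) seg_edges_props(1) by blast+
    ultimately have "\<tau>1 \<inter> \<tau>2 = seg_ends \<tau>1 \<inter> seg_ends \<tau>2" by (intro edges_Int)
    then obtain \<delta> where "\<delta> \<in> seg_ends \<tau>1" "\<delta> \<in> seg_ends \<tau>2" using a(4) by blast
    then show ?thesis using step a by blast
  qed (use a in simp)
next
  show "connected (\<Union>E)" by (rule E(2))
  show "\<tau> \<in> E" by (rule P(1))
  show "P \<tau>" by (rule P(2))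
  show "\<tau>' \<in> E" by (rule \<tau>')
qed

text \<open>Edges of one direction with a common end point lie on the same line, and this propagates
  along the chain.\<close>

lemma connected_union_level:
  assumes E: "E \<subseteq> seg_edges d" "connected (\<Union>E)" and "x \<in> \<Union>E" "y \<in> \<Union>E"
  shows "coord (\<not> d) x = coord (\<not> d) y"
proof -
  obtain \<tau> \<tau>' where t: "\<tau> \<in> E" "x \<in> \<tau>" "\<tau>' \<in> E" "y \<in> \<tau>'"
    using assms(3,4) by blast
  have seg: "is_seg d \<tau>" if "\<tau> \<in> E" for \<tau> using that E(1) seg_edges_props(3) by blast
  have "\<forall>z\<in>\<tau>'. coord (\<not> d) x = coord (\<not> d) z"
  proof (rule seg_edges_chain[OF E t(1) _ _ t(3)])
    show "\<forall>z\<in>\<tau>. coord (\<not> d) x = coord (\<not> d) z" using seg_same_level t(2) seg[OF t(1)] by blast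
  next
    fix \<tau>1 \<tau>2 \<delta> assume *: "\<tau>1 \<in> E" "\<tau>2 \<in> E" "\<forall>z\<in>\<tau>1. coord (\<not> d) x = coord (\<not> d) z" "\<delta> \<in> seg_ends \<tau>1" "\<delta> \<in> seg_ends \<tau>2"
    then have "\<delta> \<in> \<tau>1" "\<delta> \<in> \<tau>2" using seg seg_ends_subset by blast+
    then show "\<forall>z\<in>\<tau>2. coord (\<not> d) x = coord (\<not> d) z"
      using *(3) seg_same_level[OF seg[OF *(2)]] by metis
  qed
  then show ?thesis using t(4) by blast
qed

text \<open>The chain \<open>[\<gamma>] p\<close>, with the convention that
  \<open>[\<gamma>]\<close> is 0 unless \<open>\<gamma>\<close> is an interior vertex.\<close>

definition at_vertex :: "pt \<Rightarrow> bipoly \<Rightarrow> pt \<Rightarrow> bipoly" where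
  "at_vertex \<gamma> p = (\<lambda>x. if x = \<gamma> \<and> \<gamma> \<in> int_vertices T then p else 0)"

text \<open>Only the term of \<open>\<tau>\<close> survives in the sum over interior edges, and
  \<open>at_vertex\<close> absorbs end points that are not interior.\<close>

lemma boundary1_edge:
  assumes "\<tau> \<in> int_edges T"
  shows "boundary1 T (\<lambda>x. if x = \<tau> then p else 0) = at_vertex (seg_end \<tau>) p - at_vertex (seg_start \<tau>) p"
proof
  fix \<gamma>
  have "finite (int_edges T)" using finite_edges by (simp add: int_edges_def)
  then have "(\<Sum>\<tau>'\<in>int_edges T. (if seg_end \<tau>' = \<gamma> then if \<tau>' = \<tau> then p else 0 else 0) -
      (if seg_start \<tau>' = \<gamma> then if \<tau>' = \<tau> then p else 0 else 0)) =
    (\<Sum>\<tau>'\<in>{\<tau>}. (if seg_end \<tau>' = \<gamma> then if \<tau>' = \<tau> then p else 0 else 0) -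
      (if seg_start \<tau>' = \<gamma> then if \<tau>' = \<tau> then p else 0 else 0))"
    using assms by (intro sum.mono_neutral_right) auto
  then show "boundary1 T (\<lambda>x. if x = \<tau> then p else 0) \<gamma> = (at_vertex (seg_end \<tau>) p - at_vertex (seg_start \<tau>) p) \<gamma>"
    by (auto simp: boundary1_def at_vertex_def)
qed

end

section \<open>Tensors and the ideals of the edges\<close>

text \<open>Reads a univariate polynomial in the outer variable \<open>t\<close>, its coefficients
  becoming constants in \<open>s\<close>. A polynomial in \<open>s\<close> enters as a scalar of
  \<open>smult\<close>.\<close>

definition lift_t :: "real poly \<Rightarrow> bipoly" where
  "lift_t g = map_poly (\<lambda>c. [:c:]) g"

lemma coeff_lift_t [simp]: "coeff (lift_t g) i = [:coeff g i:]"
  by (simp add: lift_t_def coeff_map_poly)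

lemma lift_t_simps:
  "lift_t 0 = 0" "lift_t 1 = 1" "lift_t (p + q) = lift_t p + lift_t q" "lift_t (smult c p) = smult [:c:] (lift_t p)"
  "lift_t (pCons c p) = pCons [:c:] (lift_t p)"
proof -
  show "lift_t 1 = 1" by (rule poly_eqI) (simp add: one_pCons coeff_pCons split: nat.split)
qed (rule poly_eqI, simp add: coeff_pCons split: nat.split)+

lemma lift_t_mult: "lift_t (p * q) = lift_t p * lift_t q"
proof (induction p)
  case (pCons a p)
  have "lift_t (pCons a p * q) = lift_t (smult a q) + pCons 0 (lift_t (p * q))"
    by (simp add: lift_t_simps)
  then show ?case by (simp add: lift_t_simps pCons)
qed (simp add: lift_t_simps)

lemma lift_t_power: "lift_t (p ^ k) = lift_t p ^ k"
  by (induction k) (simp_all add: lift_t_simps lift_t_mult)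

lemma degree_lift_t: "degree (lift_t g) \<le> degree g"
  by (rule degree_le) (simp add: coeff_eq_0)

text \<open>\<open>f(s) g(t)\<close> for \<open>d = True\<close> and \<open>g(s) f(t)\<close> for \<open>d = False\<close>.\<close>
definition tensor :: "bool \<Rightarrow> real poly \<Rightarrow> real poly \<Rightarrow> bipoly" where
  "tensor d f g = (if d then smult f (lift_t g) else smult g (lift_t f))"

lemma tensor_swap: "tensor (\<not> d) g f = tensor d f g"
  by (simp add: tensor_def)

lemma tensor_linear:
  "tensor d 0 g = 0" "tensor d (f + f') g = tensor d f g + tensor d f' g"
  "tensor d (smult c f) g = smult [:c:] (tensor d f g)"
  by (auto simp: tensor_def lift_t_simps smult_add_left smult_add_right mult.commute)

lemma tensor_mult: "tensor d (f * f') (g * g') = tensor d f g * tensor d f' g'"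
  by (simp add: tensor_def lift_t_mult mult.commute)

lemma lift_t_linear_power: "lift_t ([:a, 1:] ^ k) = [:[:a:], 1:] ^ k"
  unfolding lift_t_power by (simp add: lift_t_simps flip: one_pCons)

lemma const_poly_power: "[:p ^ k:] = [:p:] ^ k" for p :: "'a :: comm_semiring_1"
proof (induction k)
  case (Suc k)
  have "[:p ^ Suc k:] = [:p:] * [:p ^ k:]" by (simp add: mult.commute)
  then show ?case unfolding Suc by simp
qed (simp add: one_pCons)

lemma tensor_linear_power:
  "tensor d 1 ([:a, 1:] ^ k) = (if d then [:[:a:], 1:] ^ k else [:[:a, 1:]:] ^ k)"
  unfolding tensor_def lift_t_linear_power lift_t_simps
  by (simp flip: const_poly_power)

text \<open>For one factor, consider the largest index at which \<open>G\<close> violates the bound.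
  The next coefficient of the product equals this coefficient minus \<open>c\<close> times one that
  obeys the bound, so it violates the bound as well.\<close>

lemma degree_coeff_divide:
  assumes "\<And>i. degree (coeff ([:[:-c:], 1:] ^ k * G) i) \<le> m"
  shows "degree (coeff (G :: bipoly) i) \<le> m"
  using assms
proof (induction k arbitrary: G i)
  case (Suc k)
  have *: "degree (coeff ([:[:-c:], 1:] * G) i) \<le> m" for i
    using Suc.prems unfolding power_Suc2 mult.assoc by (rule Suc.IH)
  show ?case
  proof (rule ccontr)
    assume "\<not> degree (coeff G i) \<le> m"
    define I where "I = {i. \<not> degree (coeff G i) \<le> m}"
    have "I \<subseteq> {..degree G}" unfolding I_def by (auto intro: le_degree)
    then have fin: "finite I" using finite_subset by blast
    have "i \<in> I" using \<open>\<not> _\<close> unfolding I_def by simp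
    then have "Max I \<in> I" "Suc (Max I) \<notin> I" using Max_in[OF fin] Max_ge[OF fin, of "Suc (Max I)"] by auto
    then have "degree (coeff G (Suc (Max I))) \<le> m" "\<not> degree (coeff G (Max I)) \<le> m"
      unfolding I_def by auto
    moreover have "coeff G (Max I) = coeff ([:[:-c:], 1:] * G) (Suc (Max I)) + smult c (coeff G (Suc (Max I)))"
      by simp
    moreover have "degree (smult c (coeff G (Suc (Max I)))) \<le> m"
      using calculation(1) by (rule order_trans[OF degree_smult_le])
    ultimately show False using degree_add_le[OF *] by metis
  qed
qed simp

section \<open>The ideal of a line and its expansion into tensors\<close>

locale spline = mesh +
  fixes rh rv :: "real \<Rightarrow> nat" and m m' :: nat
begin

definition deg_bound :: "bool \<Rightarrow> nat" where "deg_bound d = (if d then m else m')"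

text \<open>\<open>order_at d a\<close> belongs to the line on which \<open>coord d\<close> equals
  \<open>a\<close>; that line has direction \<open>\<not> d\<close>.\<close>

definition order_at :: "bool \<Rightarrow> real \<Rightarrow> nat" where "order_at d = (if d then rh else rv)"

text \<open>The common ideal of all edges of direction \<open>d\<close> at level \<open>c\<close>.
  As it depends on the line alone, a polynomial can travel along a segment.\<close>

definition line_ideal :: "bool \<Rightarrow> real \<Rightarrow> bipoly set" where
  "line_ideal d c = {p. tensor d 1 ([:-c, 1:] ^ (order_at (\<not> d) c + 1)) dvd p} \<inter> R_space m m'"

lemma edge_ideal_eq:
  assumes "is_seg d \<tau>" "x \<in> \<tau>"
  shows "edge_ideal rh rv m m' \<tau> = line_ideal d (coord (\<not> d) x)"
    and "smoothness rh rv \<tau> = order_at (\<not> d) (coord (\<not> d) x)"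
proof -
  have "Delta rh rv \<tau> = tensor d 1 ([:-coord (\<not> d) x, 1:] ^ (order_at (\<not> d) (coord (\<not> d) x) + 1)) \<and>
    smoothness rh rv \<tau> = order_at (\<not> d) (coord (\<not> d) x)"
  proof (cases d)
    case True
    then obtain a b c where t: "a < b" "\<tau> = {a..b} \<times> {c}"
      using assms unfolding is_seg_def is_hseg_def by auto
    then have "is_hseg \<tau>" "hlevel \<tau> = c" "coord (\<not> d) x = c"
      using True assms(2) by (auto simp: is_hseg_def hlevel_seg coord_def)
    then show ?thesis using True
      by (simp only: Delta_def line_poly_def smoothness_def tensor_linear_power order_at_def if_True not_True_eq_False if_False)
  next
    case False
    then obtain a b c where t: "a < b" "\<tau> = {c} \<times> {a..b}"
      using assms unfolding is_seg_def is_vseg_def by auto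
    have "\<not> is_hseg \<tau>"
      using seg_direction[of True \<tau> False c] t by (auto simp: is_seg_def coord_def)
    moreover have "vlevel \<tau> = c" "coord (\<not> d) x = c"
      using False assms(2) t by (auto simp: vlevel_seg coord_def)
    ultimately show ?thesis using False
      by (simp only: Delta_def line_poly_def smoothness_def tensor_linear_power order_at_def if_True not_False_eq_True if_False)
  qed
  then show "edge_ideal rh rv m m' \<tau> = line_ideal d (coord (\<not> d) x)"
    and "smoothness rh rv \<tau> = order_at (\<not> d) (coord (\<not> d) x)"
    by (simp_all add: edge_ideal_def line_ideal_def)
qed

lemma tensor_R_space:
  assumes "degree f \<le> deg_bound d" "degree g \<le> deg_bound (\<not> d)"
  shows "tensor d f g \<in> R_space m m'"
proof (cases d)
  case True
  then have "degree (smult f (lift_t g)) \<le> m'"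
    using assms degree_lift_t[of g] by (intro order_trans[OF degree_smult_le]) (auto simp: deg_bound_def)
  moreover have "degree (f * [:coeff g i:]) \<le> m" for i
    using True assms by (simp add: deg_bound_def)
  ultimately show ?thesis using True by (simp add: tensor_def R_space_def)
next
  case False
  then have "degree (smult g (lift_t f)) \<le> m'"
    using assms degree_lift_t[of f] by (intro order_trans[OF degree_smult_le]) (auto simp: deg_bound_def)
  moreover have "degree (g * [:coeff f i:]) \<le> m" for i
    using False assms by (simp add: deg_bound_def)
  ultimately show ?thesis using False by (simp add: tensor_def R_space_def)
qed

lemma tensor_line_ideal:
  assumes "degree f \<le> deg_bound d" "degree g \<le> deg_bound (\<not> d)" "[:-c, 1:] ^ (order_at (\<not> d) c + 1) dvd g"
  shows "tensor d f g \<in> line_ideal d c"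
proof -
  obtain h where "g = [:-c, 1:] ^ (order_at (\<not> d) c + 1) * h" using assms(3) by (rule dvdE)
  then have "tensor d f g = tensor d 1 ([:-c, 1:] ^ (order_at (\<not> d) c + 1)) * tensor d f h"
    by (metis mult_1 tensor_mult)
  then show ?thesis using tensor_R_space[OF assms(1,2)] unfolding line_ideal_def by simp
qed

text \<open>Dividing by the power of the line leaves transversal degree below
  \<open>deg_bound (\<not> d) - r\<close>; expanding the quotient in the transversal variable gives
  one \<open>F j\<close> per exponent. For \<open>r\<close> at or above the bound the sum is empty
  and the ideal is zero.\<close>

lemma line_ideal_expand:
  assumes "p \<in> line_ideal d c"
  defines "r \<equiv> order_at (\<not> d) c"
  obtains F where "\<And>j. degree (F j) \<le> deg_bound d"
    "p = (\<Sum>j<deg_bound (\<not> d) - r. tensor d (F j) ([:-c, 1:] ^ (r + 1) * monom 1 j))"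
proof (cases d)
  case True
  have R: "degree p \<le> m'" "\<And>i. degree (coeff p i) \<le> m"
    using assms by (auto simp: line_ideal_def R_space_def)
  define L where "L = [:[:-c:], 1:] ^ (r + 1)"
  have L: "degree L = r + 1" unfolding L_def by (rule degree_linear_power)
  then have "L \<noteq> 0" by auto
  have "L dvd p"
    using assms(1) True unfolding line_ideal_def tensor_linear_power L_def r_def by simp
  then obtain G where G: "p = L * G" by (rule dvdE)
  have degF: "degree (coeff G i) \<le> m" for i
    using R(2) unfolding G L_def by (rule degree_coeff_divide)
  have zero: "coeff G i = 0" if "i \<ge> m' - r" for i
  proof (cases "G = 0")
    case False
    have "degree p = r + 1 + degree G"
      unfolding G using False \<open>L \<noteq> 0\<close> L by (simp add: degree_mult_eq)
    then have "degree G < i" using R(1) that by linarith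
    then show ?thesis by (simp add: coeff_eq_0)
  qed simp
  have "G = (\<Sum>j<m' - r. monom (coeff G j) j)"
    by (rule poly_eqI) (use zero in \<open>auto simp: coeff_sum sum.delta not_less\<close>)
  also have "\<dots> = (\<Sum>j<m' - r. smult (coeff G j) (lift_t (monom 1 j)))"
    by (intro sum.cong refl poly_eqI) (auto simp: one_pCons)
  finally have "p = L * (\<Sum>j<m' - r. smult (coeff G j) (lift_t (monom 1 j)))"
    using G by simp
  also have "\<dots> = (\<Sum>j<m' - r. tensor d (coeff G j) ([:-c, 1:] ^ (r + 1) * monom 1 j))"
    unfolding tensor_def lift_t_mult lift_t_linear_power L_def[symmetric] using True
    by (simp add: sum_distrib_left)
  finally show ?thesis using True degF by (intro that[of "coeff G"]) (simp_all add: deg_bound_def)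
next
  case False
  have R: "degree p \<le> m'" "\<And>i. degree (coeff p i) \<le> m"
    using assms by (auto simp: line_ideal_def R_space_def)
  define q where "q = [:-c, 1:] ^ (r + 1)"
  have "[:q:] dvd p"
    using assms(1) False unfolding line_ideal_def tensor_linear_power q_def r_def const_poly_power by simp
  then have "\<exists>h. coeff p i = q * h" for i by (auto simp: const_poly_dvd_iff elim: dvdE)
  then obtain h where h: "\<And>i. coeff p i = q * h i" by metis
  have q: "degree q = r + 1" unfolding q_def by (rule degree_linear_power)
  then have "q \<noteq> 0" by auto
  have zero: "coeff (h i) j = 0" if "j \<ge> m - r" for i j
  proof (cases "h i = 0")
    case False
    have "degree (coeff p i) = r + 1 + degree (h i)"
      unfolding h using False q \<open>q \<noteq> 0\<close> by (simp add: degree_mult_eq)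
    then have "degree (h i) < j" using R(2)[of i] that by linarith
    then show ?thesis by (simp add: coeff_eq_0)
  qed simp
  \<comment> \<open>Transposition: \<open>F j\<close> collects, over all powers of \<open>t\<close>,
    the coefficients of the \<open>j\<close>-th power of \<open>s\<close>.\<close>
  define F where "F j = (\<Sum>i\<le>m'. monom (coeff (h i) j) i)" for j
  have coeff_F: "coeff (F j) i = coeff (h i) j" for i j
  proof (cases "i \<le> m'")
    case False
    then have "coeff p i = 0" using R(1) by (intro coeff_eq_0) simp
    then have "h i = 0" using h[of i] \<open>q \<noteq> 0\<close> by simp
    then show ?thesis using False by (simp add: F_def coeff_sum)
  qed (simp add: F_def coeff_sum)
  have "p = (\<Sum>j<m - r. smult (q * monom 1 j) (lift_t (F j)))"
  proof (rule poly_eqI)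
    fix i
    have "h i = (\<Sum>j<m - r. monom (coeff (h i) j) j)"
      by (rule poly_eqI) (use zero in \<open>auto simp: coeff_sum not_less\<close>)
    then have "coeff p i = q * (\<Sum>j<m - r. monom (coeff (h i) j) j)" using h by simp
    also have "\<dots> = (\<Sum>j<m - r. q * monom 1 j * [:coeff (F j) i:])"
      unfolding sum_distrib_left
    proof (rule sum.cong)
      fix j
      have "monom (coeff (h i) j) j = smult (coeff (h i) j) (monom 1 j)" by (simp add: smult_monom)
      then show "q * monom (coeff (h i) j) j = q * monom 1 j * [:coeff (F j) i:]"
        by (simp add: coeff_F)
    qed simp
    finally show "coeff p i = coeff (\<Sum>j<m - r. smult (q * monom 1 j) (lift_t (F j))) i"
      by (simp add: coeff_sum)
  qed
  moreover have "degree (F j) \<le> m'" for j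
    by (rule degree_le) (auto simp: F_def coeff_sum)
  ultimately show ?thesis using False by (intro that[of F]) (simp_all add: deg_bound_def tensor_def q_def del: power_Suc)
qed

section \<open>Moving classes along segments modulo boundaries\<close>

definition boundaries :: "(pt \<Rightarrow> bipoly) set" where
  "boundaries = boundary1 T ` direct_sum (int_edges T) (edge_ideal rh rv m m')"

lemma smult_sum_right: "smult c (\<Sum>i\<in>I. f i) = (\<Sum>i\<in>I. smult c (f i))"
  by (induction I rule: infinite_finite_induct) (simp_all add: smult_add_right)

lemma edge_ideal_closed:
  "0 \<in> edge_ideal rh rv m m' \<tau>"
  "p \<in> edge_ideal rh rv m m' \<tau> \<Longrightarrow> q \<in> edge_ideal rh rv m m' \<tau> \<Longrightarrow> p + q \<in> edge_ideal rh rv m m' \<tau>"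
  "p \<in> edge_ideal rh rv m m' \<tau> \<Longrightarrow> smult [:c:] p \<in> edge_ideal rh rv m m' \<tau>"
  by (auto simp: edge_ideal_def R_space_def intro: degree_add_le dvd_smult order_trans[OF degree_smult_le])

lemma subspace_boundaries: "fs.subspace boundaries"
  unfolding boundaries_def
proof (rule fs.subspaceI)
  let ?D = "direct_sum (int_edges T) (edge_ideal rh rv m m')"
  have "(0 :: pt set \<Rightarrow> bipoly) \<in> ?D" by (simp add: direct_sum_def edge_ideal_closed)
  moreover have "boundary1 T 0 = 0" by (rule ext) (simp add: boundary1_def zero_fun_def)
  ultimately show "0 \<in> boundary1 T ` ?D" by (metis imageI)
next
  let ?D = "direct_sum (int_edges T) (edge_ideal rh rv m m')"
  fix x y assume "x \<in> boundary1 T ` ?D" "y \<in> boundary1 T ` ?D"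
  then obtain f g where fg: "f \<in> ?D" "g \<in> ?D" "x = boundary1 T f" "y = boundary1 T g" by auto
  have "f + g \<in> ?D" using fg(1,2) by (simp add: direct_sum_def edge_ideal_closed)
  moreover have "boundary1 T (f + g) = x + y"
    unfolding fg boundary1_def fun_eq_iff by (auto simp flip: sum.distrib intro!: sum.cong)
  ultimately show "x + y \<in> boundary1 T ` ?D" by (metis imageI)
next
  let ?D = "direct_sum (int_edges T) (edge_ideal rh rv m m')"
  fix c x assume "x \<in> boundary1 T ` ?D"
  then obtain f where f: "f \<in> ?D" "x = boundary1 T f" by auto
  have "fscale c f \<in> ?D" using f(1) by (simp add: direct_sum_def edge_ideal_closed fscale_def)
  moreover have "boundary1 T (fscale c f) = fscale c x"
    unfolding f boundary1_def fun_eq_iff fscale_def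
    by (auto simp: smult_sum_right smult_diff_right intro!: sum.cong)
  ultimately show "fscale c x \<in> boundary1 T ` ?D" by (metis imageI)
qed

lemma at_vertex_linear:
  "at_vertex \<gamma> 0 = 0" "at_vertex \<gamma> (p + q) = at_vertex \<gamma> p + at_vertex \<gamma> q" "at_vertex \<gamma> (smult [:c:] p) = fscale c (at_vertex \<gamma> p)"
  by (auto simp: at_vertex_def fscale_def fun_eq_iff)

lemma at_vertex_sum: "at_vertex \<gamma> (\<Sum>j\<in>J. f j) = (\<Sum>j\<in>J. at_vertex \<gamma> (f j))"
  by (induction J rule: infinite_finite_induct) (auto simp: at_vertex_linear)

text \<open>Apply \<open>boundary1\<close> to the chain with value \<open>p\<close> on
  \<open>\<tau>\<close> alone; the sign covers both orders of the end points, and for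
  \<open>x = y\<close> the difference is 0.\<close>

lemma edge_in_boundaries:
  assumes "\<tau> \<in> int_edges T" "p \<in> edge_ideal rh rv m m' \<tau>" "x \<in> seg_ends \<tau>" "y \<in> seg_ends \<tau>"
  shows "at_vertex x p - at_vertex y p \<in> boundaries"
proof -
  have "(\<lambda>x. if x = \<tau> then p else 0) \<in> direct_sum (int_edges T) (edge_ideal rh rv m m')"
    using assms by (auto simp: direct_sum_def edge_ideal_closed)
  then have *: "at_vertex (seg_end \<tau>) p - at_vertex (seg_start \<tau>) p \<in> boundaries"
    unfolding boundaries_def boundary1_edge[OF assms(1), symmetric] by (rule imageI)
  then have "at_vertex (seg_start \<tau>) p - at_vertex (seg_end \<tau>) p \<in> boundaries"
    using fs.subspace_neg[OF subspace_boundaries *] by simp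
  then show ?thesis
    using * assms(3,4) fs.subspace_0[OF subspace_boundaries] unfolding seg_ends_def by auto
qed

text \<open>All edges in \<open>E\<close> have the same level, so \<open>p\<close> belongs to each
  of their ideals. The boundaries of the single edges telescope along the chain.\<close>

lemma transport:
  assumes E: "E \<subseteq> seg_edges d" "connected (\<Union>E)"
    and x: "x \<in> vertices T" "x \<in> \<Union>E" and y: "y \<in> vertices T" "y \<in> \<Union>E"
    and p: "p \<in> line_ideal d (coord (\<not> d) x)"
  shows "at_vertex x p - at_vertex y p \<in> boundaries"
proof -
  obtain \<tau> \<tau>' where t: "\<tau> \<in> E" "x \<in> \<tau>" "\<tau>' \<in> E" "y \<in> \<tau>'" using x(2) y(2) by blast
  have ends: "z \<in> seg_ends \<tau>" if "\<tau> \<in> E" "z \<in> \<tau>" "z \<in> vertices T" for z \<tau>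
    using vertex_on_edge[OF that(3) _ that(2)] seg_edges_props(1) E(1) that(1) by blast
  have edge: "at_vertex z p - at_vertex w p \<in> boundaries" if "\<tau> \<in> E" "z \<in> seg_ends \<tau>" "w \<in> seg_ends \<tau>" for z w \<tau>
  proof -
    have \<tau>: "\<tau> \<in> seg_edges d" using E(1) that(1) by blast
    have z: "z \<in> \<tau>" using seg_ends_subset[OF seg_edges_props(3)[OF \<tau>]] that(2) by blast
    then have "coord (\<not> d) z = coord (\<not> d) x"
      using that(1) x(2) by (intro connected_union_level[OF E]) auto
    then have "p \<in> edge_ideal rh rv m m' \<tau>"
      using edge_ideal_eq(1)[OF seg_edges_props(3)[OF \<tau>] z] p by simp
    then show ?thesis using edge_in_boundaries[OF seg_edges_props(2)[OF \<tau>]] that by blast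
  qed
  have "\<forall>z\<in>seg_ends \<tau>'. at_vertex x p - at_vertex z p \<in> boundaries"
  proof (rule seg_edges_chain[OF E t(1) _ _ t(3)])
    show "\<forall>z\<in>seg_ends \<tau>. at_vertex x p - at_vertex z p \<in> boundaries"
      using edge[OF t(1) ends[OF t(1,2) x(1)]] by blast
  next
    fix \<tau>1 \<tau>2 \<delta> assume *: "\<tau>1 \<in> E" "\<tau>2 \<in> E" "\<forall>z\<in>seg_ends \<tau>1. at_vertex x p - at_vertex z p \<in> boundaries"
      "\<delta> \<in> seg_ends \<tau>1" "\<delta> \<in> seg_ends \<tau>2"
    show "\<forall>z\<in>seg_ends \<tau>2. at_vertex x p - at_vertex z p \<in> boundaries"
    proof
      fix z assume "z \<in> seg_ends \<tau>2"
      then have "at_vertex \<delta> p - at_vertex z p \<in> boundaries" using edge[OF *(2,5)] by blast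
      moreover have "at_vertex x p - at_vertex \<delta> p \<in> boundaries" using *(3,4) by blast
      ultimately have "(at_vertex x p - at_vertex \<delta> p) + (at_vertex \<delta> p - at_vertex z p) \<in> boundaries"
        using fs.subspace_add[OF subspace_boundaries] by blast
      then show "at_vertex x p - at_vertex z p \<in> boundaries" by (simp add: algebra_simps)
    qed
  qed
  then show ?thesis using ends[OF t(3,4) y(1)] by blast
qed

text \<open>The relative interior of an interior edge avoids the frontier, so the segment reaches it
  at a vertex. There \<open>at_vertex\<close> is 0, and transport to this vertex makes the class
  vanish.\<close>

lemma transport_frontier:
  assumes E: "E \<subseteq> seg_edges d" "connected (\<Union>E)" "\<Union>E \<inter> frontier \<Omega> \<noteq> {}"
    and x: "x \<in> vertices T" "x \<in> \<Union>E"
    and p: "p \<in> line_ideal d (coord (\<not> d) x)"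
  shows "at_vertex x p \<in> boundaries"
proof -
  obtain y \<tau> where y: "\<tau> \<in> E" "y \<in> \<tau>" "y \<in> frontier \<Omega>" using E(3) by blast
  have \<tau>: "\<tau> \<in> seg_edges d" using E(1) y(1) by blast
  have "y \<notin> interior \<Omega>" using y(3) by (simp add: frontier_def)
  then have "y \<in> seg_ends \<tau>" using int_edge_relint[OF seg_edges_props(2)[OF \<tau>] y(2)] by blast
  then have "y \<in> vertices T" unfolding vertices_def using seg_edges_props(1)[OF \<tau>] by blast
  then have "at_vertex x p - at_vertex y p \<in> boundaries" using y by (intro transport[OF E(1,2) x _ _ p]) auto
  moreover have "at_vertex y p = 0" using \<open>y \<notin> interior \<Omega>\<close> by (auto simp: at_vertex_def int_vertices_def)
  ultimately show ?thesis by simp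
qed

text \<open>The maximal segment through \<open>x\<close> either reaches the frontier, which kills
  the class, or is a maximal interior segment.\<close>

lemma vertex_cases:
  assumes x: "x \<in> int_vertices T" and p: "p \<in> line_ideal d (coord (\<not> d) x)"
  shows "at_vertex x p \<in> boundaries \<or> (\<exists>\<rho>\<in>MISd d. x \<in> \<rho>)"
proof -
  have xv: "x \<in> vertices T" using x by (simp add: int_vertices_def)
  obtain \<tau> where \<tau>: "\<tau> \<in> edges T" "is_seg d \<tau>" "x \<in> \<tau>" using vertex_edges[OF xv] by blast
  then have td: "\<tau> \<in> seg_edges d" using edge_at_int_vertex[OF x] by (simp add: seg_edges_def)
  then obtain \<rho> where \<rho>: "is_maximal_segment (seg_edges d) \<tau> \<rho>" using ex_maximal_segment by blast
  then obtain E where E: "E \<subseteq> seg_edges d" "\<tau> \<in> E" "\<rho> = \<Union>E" "connected (\<Union>E)" by (rule maximal_segmentE)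
  show ?thesis
  proof (cases "\<rho> \<inter> frontier \<Omega> = {}")
    case True
    then have "\<rho> \<in> MISd d" unfolding MISd_eq using \<rho> td by blast
    then show ?thesis using E(2,3) \<tau>(3) by blast
  next
    case False
    then show ?thesis
      using transport_frontier[OF E(1,4) _ xv _ p] E(2,3) \<tau>(3) by blast
  qed
qed

section \<open>Maximal interior segments in either direction\<close>

lemma MISdE:
  assumes "\<rho> \<in> MISd d"
  obtains E where "E \<subseteq> seg_edges d" "E \<noteq> {}" "\<rho> = \<Union>E" "connected (\<Union>E)"
  using assms unfolding MISd_eq by (auto elim: maximal_segmentE)

lemma MISd_edge:
  assumes "\<rho> \<in> MISd d"
  shows "\<exists>\<tau>\<in>seg_edges d. \<tau> \<subseteq> \<rho>"
proof (rule MISdE[OF assms])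
  fix E assume "E \<subseteq> seg_edges d" "E \<noteq> {}" "\<rho> = \<Union>E"
  then show ?thesis by blast
qed

lemma finite_MISd: "finite (MISd d)"
proof (rule finite_subset)
  show "MISd d \<subseteq> Union ` Pow (seg_edges d)" by (auto elim!: MISdE)
qed (simp add: finite_seg_edges)

lemma MISd_level: "\<rho> \<in> MISd d \<Longrightarrow> x \<in> \<rho> \<Longrightarrow> y \<in> \<rho> \<Longrightarrow> coord (\<not> d) x = coord (\<not> d) y"
  by (metis MISdE connected_union_level)

lemma MISd_vertex:
  assumes "\<rho> \<in> MISd d"
  shows "\<exists>\<gamma>. \<gamma> \<in> vertices T \<and> \<gamma> \<in> \<rho>"
proof -
  obtain \<tau> where \<tau>: "\<tau> \<in> seg_edges d" "\<tau> \<subseteq> \<rho>" using MISd_edge[OF assms] by blast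
  then have "seg_end \<tau> \<in> \<tau>" using seg_ends_subset[OF seg_edges_props(3)[OF \<tau>(1)]] by (auto simp: seg_ends_def)
  moreover have "seg_end \<tau> \<in> vertices T"
    unfolding vertices_def seg_ends_def using seg_edges_props(1)[OF \<tau>(1)] by blast
  ultimately show ?thesis using \<tau>(2) by blast
qed

text \<open>If the directions differed, both coordinates would be constant on a set that contains an
  edge.\<close>

lemma MISd_direction:
  assumes "\<rho> \<in> MISd d" "\<rho> \<in> MISd e"
  shows "e = d"
proof -
  obtain \<tau> where "\<tau> \<in> seg_edges d" and \<tau>: "\<tau> \<subseteq> \<rho>" using MISd_edge[OF assms(1)] by blast
  then have "is_seg d \<tau>" by (intro seg_edges_props(3))
  obtain x where "x \<in> \<rho>" using MISd_vertex[OF assms(1)] by blast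
  then have "coord (\<not> e) y = coord (\<not> e) x" if "y \<in> \<tau>" for y
    using MISd_level[OF assms(2)] \<tau> that by blast
  with \<open>is_seg d \<tau>\<close> show ?thesis by (rule seg_direction)
qed

lemma MISd_interior:
  assumes "\<rho> \<in> MISd d" "x \<in> \<rho>"
  shows "x \<in> interior \<Omega>"
proof -
  obtain E where E: "E \<subseteq> seg_edges d" "\<rho> = \<Union>E" using MISdE[OF assms(1)] by blast
  then obtain \<tau> where "\<tau> \<in> seg_edges d" "x \<in> \<tau>" using assms(2) by blast
  then have "x \<in> \<Omega>" using edge_subset_domain seg_edges_props(1) by blast
  moreover have "x \<notin> frontier \<Omega>" using assms unfolding MISd_eq by blast
  ultimately show ?thesis by (simp add: frontier_def closed_domain)
qed

lemma MIS_iff: "\<rho> \<in> MIS T \<longleftrightarrow> (\<exists>d. \<rho> \<in> MISd d)"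
  unfolding MIS_def MISd_def by (auto split: if_splits)

lemma MISd_transport:
  assumes \<rho>: "\<rho> \<in> MISd d" and "x \<in> vertices T" "x \<in> \<rho>" "y \<in> vertices T" "y \<in> \<rho>"
    and "p \<in> line_ideal d (coord (\<not> d) x)"
  shows "at_vertex x p - at_vertex y p \<in> boundaries"
proof -
  obtain E where "E \<subseteq> seg_edges d" "\<rho> = \<Union>E" "connected (\<Union>E)" using MISdE[OF \<rho>] by blast
  then show ?thesis using transport assms by blast
qed

text \<open>Shows that the definite description is unambiguous: any edge inside
  \<open>\<rho>\<close> lies on one level, so it has direction \<open>d\<close> and the order of
  that line, and such an edge exists.\<close>

lemma seg_smoothness_eq:
  assumes "\<rho> \<in> MISd d" "x \<in> \<rho>"
  shows "seg_smoothness T rh rv \<rho> = order_at (\<not> d) (coord (\<not> d) x)"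
proof -
  have *: "smoothness rh rv \<tau> = order_at (\<not> d) (coord (\<not> d) x)" if \<tau>: "\<tau> \<in> edges T" "\<tau> \<subseteq> \<rho>" for \<tau>
  proof -
    obtain e where e: "is_seg e \<tau>" using edge_seg \<tau>(1) by blast
    have lev: "coord (\<not> d) y = coord (\<not> d) x" if "y \<in> \<tau>" for y
      using MISd_level[OF assms(1)] assms(2) \<tau>(2) that by blast
    then have "d = e" using seg_direction[OF e] by blast
    moreover obtain y where y: "y \<in> \<tau>" using seg_ends_subset[OF e] seg_ends_ne by blast
    ultimately show ?thesis using edge_ideal_eq(2)[OF e y] lev[OF y] by simp
  qed
  obtain \<tau> where "\<tau> \<in> seg_edges d" "\<tau> \<subseteq> \<rho>" using MISd_edge[OF assms(1)] by blast
  then have "\<tau> \<in> edges T" "\<tau> \<subseteq> \<rho>" using seg_edges_props(1)[of \<tau>] by auto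
  then show ?thesis unfolding seg_smoothness_def using * by (intro the_equality) blast+
qed

lemma weight_eq:
  assumes "\<rho> \<in> MISd d"
  shows "weight T rh rv m m' \<iota> \<rho> = (\<Sum>\<gamma>\<in>Gamma_ord T \<iota> \<rho>. int (deg_bound d) - int (order_at d (coord d \<gamma>)))"
proof (cases d)
  case True
  then show ?thesis using assms by (simp add: weight_def MISd_def deg_bound_def order_at_def coord_def)
next
  case False
  \<comment> \<open>\<open>weight\<close> tests for horizontal segments first, so its second branch
    requires that no vertical segment is also horizontal.\<close>
  then have "\<rho> \<notin> MIS_h T" using MISd_direction[OF assms, of True] by (auto simp: MISd_def)
  then show ?thesis using False by (simp add: weight_def deg_bound_def order_at_def coord_def)
qed

section \<open>The bound\<close>

text \<open>For \<open>X\<close> containing the boundaries this says that all classes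
  \<open>[\<rho>] p\<close> lie in \<open>X\<close>. The quantifier over vertices lets transversal
  segments use it at their own crossing points.\<close>

definition spans_segment :: "bool \<Rightarrow> (pt \<Rightarrow> bipoly) set \<Rightarrow> pt set \<Rightarrow> bool" where
  "spans_segment d X \<rho> \<longleftrightarrow> (\<forall>\<gamma>\<in>vertices T \<inter> \<rho>. \<forall>p\<in>line_ideal d (coord (\<not> d) \<gamma>). at_vertex \<gamma> p \<in> X)"

text \<open>At a vertex of \<open>\<Gamma>(\<rho>)\<close> the polynomials vanishing to the prescribed order along both
  segments can be moved to the transversal segment, which comes earlier or meets the boundary.\<close>
lemma segment_step:
  assumes \<iota>: "is_ordering T \<iota>" and \<rho>: "\<rho> \<in> MISd d"
  obtains S where "finite S"
    "int (card S) \<le> max 0 (int (deg_bound d) + 1 - weight T rh rv m m' \<iota> \<rho>) *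
       max 0 (int (deg_bound (\<not> d)) - int (seg_smoothness T rh rv \<rho>))"
    "\<And>X. fs.subspace X \<Longrightarrow> boundaries \<subseteq> X \<Longrightarrow> S \<subseteq> X \<Longrightarrow>
      (\<And>\<rho>'. \<rho>' \<in> MISd (\<not> d) \<Longrightarrow> \<iota> \<rho>' < \<iota> \<rho> \<Longrightarrow> spans_segment (\<not> d) X \<rho>') \<Longrightarrow>
      spans_segment d X \<rho>"
proof -
  obtain \<gamma>0 where \<gamma>0: "\<gamma>0 \<in> vertices T" "\<gamma>0 \<in> \<rho>" using MISd_vertex[OF \<rho>] by blast
  define c where "c = coord (\<not> d) \<gamma>0"
  have level: "coord (\<not> d) x = c" if "x \<in> \<rho>" for x
    unfolding c_def using MISd_level[OF \<rho>] that \<gamma>0(2) by blast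
  define r where "r = order_at (\<not> d) c"
  have smooth: "seg_smoothness T rh rv \<rho> = r"
    unfolding r_def c_def by (rule seg_smoothness_eq[OF \<rho> \<gamma>0(2)])
  define \<Gamma> where "\<Gamma> = Gamma_ord T \<iota> \<rho>"
  have \<Gamma>: "\<Gamma> \<subseteq> vertices T" "\<Gamma> \<subseteq> \<rho>" unfolding \<Gamma>_def Gamma_ord_def by auto
  have fin: "finite \<Gamma>" using \<Gamma>(1) finite_vertices finite_subset by blast
  have inj: "inj_on (coord d) \<Gamma>"
  proof (rule inj_onI)
    fix x y assume "x \<in> \<Gamma>" "y \<in> \<Gamma>" "coord d x = coord d y"
    moreover then have "coord (\<not> d) x = c" "coord (\<not> d) y = c" using level \<Gamma>(2) by blast+
    ultimately show "x = y" by (intro coord_eqI[of d]) simp_all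
  qed
  \<comment> \<open>Truncated subtraction yields positive parts. The weight adds the untruncated
    terms, so it is at most the sum of \<open>e\<close>, which is the direction the bound
    needs.\<close>
  define e where "e a = deg_bound d - order_at d a" for a
  \<comment> \<open>The transversal factors of \<open>line_ideal_expand\<close>; each
    \<open>j \<in> J\<close> contributes one copy of the quotient in the variable along
    \<open>\<rho>\<close>.\<close>
  define g where "g j = [:-c, 1:] ^ (r + 1) * monom 1 j" for j :: nat
  define J where "J = {..<deg_bound (\<not> d) - r}"
  obtain Q where Q: "finite Q" "card Q \<le> deg_bound d + 1 - sum e (coord d ` \<Gamma>)"
    and Qspan: "\<And>f. degree f \<le> deg_bound d \<Longrightarrow>
      f \<in> rp.span (Q \<union> {[:-a, 1:] ^ k | a k. a \<in> coord d ` \<Gamma> \<and> k \<le> deg_bound d \<and> deg_bound d < k + e a})"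
    using polar_complement[OF finite_imageI[OF fin], where m = "deg_bound d" and d = e] by blast
  define S where "S = (\<lambda>(q, j). at_vertex \<gamma>0 (tensor d q (g j))) ` (Q \<times> J)"
  have degg: "degree (g j) \<le> deg_bound (\<not> d)" if "j \<in> J" for j
  proof -
    have "degree (g j) \<le> (r + 1) + j"
      unfolding g_def using degree_mult_le[of "[:-c, 1:] ^ (r + 1)" "monom 1 j"]
      by (simp only: degree_linear_power degree_monom_eq one_neq_zero simp_thms)
    then show ?thesis using that by (simp add: J_def)
  qed
  have ideal: "tensor d f (g j) \<in> line_ideal d c" if "degree f \<le> deg_bound d" "j \<in> J" for f j
    using that degg by (intro tensor_line_ideal) (auto simp: g_def r_def simp del: power_Suc)
  show ?thesis
  proof (rule that)
    show "finite S" unfolding S_def J_def using Q(1) by simp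
    have "weight T rh rv m m' \<iota> \<rho> \<le> (\<Sum>\<gamma>\<in>\<Gamma>. int (e (coord d \<gamma>)))"
      unfolding weight_eq[OF \<rho>] \<Gamma>_def[symmetric] e_def by (intro sum_mono) simp
    also have "\<dots> = int (sum e (coord d ` \<Gamma>))" by (simp add: sum.reindex[OF inj])
    finally have "int (card Q) \<le> max 0 (int (deg_bound d) + 1 - weight T rh rv m m' \<iota> \<rho>)"
      using Q(2) by linarith
    moreover have cardS: "card S \<le> card Q * card J"
      unfolding S_def using Q(1) by (intro order_trans[OF card_image_le]) (simp_all add: J_def card_cartesian_product)
    moreover have "int (card J) = max 0 (int (deg_bound (\<not> d)) - int (seg_smoothness T rh rv \<rho>))"
      unfolding smooth J_def by simp
    ultimately have "int (card Q) * int (card J) \<le> max 0 (int (deg_bound d) + 1 - weight T rh rv m m' \<iota> \<rho>) *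
       max 0 (int (deg_bound (\<not> d)) - int (seg_smoothness T rh rv \<rho>))"
      by (intro mult_mono) simp_all
    moreover have "int (card S) \<le> int (card Q) * int (card J)"
      using cardS by (simp flip: of_nat_mult)
    ultimately show "int (card S) \<le> max 0 (int (deg_bound d) + 1 - weight T rh rv m m' \<iota> \<rho>) *
       max 0 (int (deg_bound (\<not> d)) - int (seg_smoothness T rh rv \<rho>))"
      by (rule order_trans[rotated])
  next
    fix X assume X: "fs.subspace X" "boundaries \<subseteq> X" "S \<subseteq> X"
      and IH: "\<And>\<rho>'. \<rho>' \<in> MISd (\<not> d) \<Longrightarrow> \<iota> \<rho>' < \<iota> \<rho> \<Longrightarrow> spans_segment (\<not> d) X \<rho>'"
    have move: "at_vertex y p \<in> X" if "at_vertex x p \<in> X" "x \<in> vertices T" "x \<in> \<rho>" "y \<in> vertices T" "y \<in> \<rho>"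
      "p \<in> line_ideal d c" for x y p
    proof -
      have "at_vertex y p - at_vertex x p \<in> X"
        using MISd_transport[OF \<rho> that(4,5,2,3)] that(6) level[OF that(5)] X(2) by auto
      from fs.subspace_add[OF X(1) this that(1)] show ?thesis by simp
    qed
    \<comment> \<open>By linearity only the spanning set of \<open>polar_complement\<close> matters.
      Elements of \<open>Q\<close> give members of \<open>S\<close>; a power at \<open>a\<close> is
      treated at the vertex of \<open>\<Gamma>\<close> with coordinate \<open>a\<close> and then
      moved back to \<open>\<gamma>0\<close>.\<close>
    have base: "at_vertex \<gamma>0 (tensor d f (g j)) \<in> X" if f: "degree f \<le> deg_bound d" and j: "j \<in> J" for f j
    proof -
      let ?P = "{f. at_vertex \<gamma>0 (tensor d f (g j)) \<in> X}"
      have "rp.subspace ?P"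
        by (rule rp.subspaceI)
          (auto simp: tensor_linear at_vertex_linear intro: fs.subspace_0 fs.subspace_add fs.subspace_scale X(1))
      moreover have "Q \<subseteq> ?P" using X(3) j unfolding S_def by auto
      moreover have "[:-a, 1:] ^ k \<in> ?P" if a: "a \<in> coord d ` \<Gamma>" and k: "k \<le> deg_bound d" "deg_bound d < k + e a" for a k
      proof -
        obtain \<gamma> where \<gamma>: "\<gamma> \<in> \<Gamma>" "a = coord d \<gamma>" using a by blast
        have \<gamma>\<rho>: "\<gamma> \<in> vertices T" "\<gamma> \<in> \<rho>" using \<gamma>(1) \<Gamma> by auto
        have int: "\<gamma> \<in> int_vertices T"
          using \<gamma>\<rho> MISd_interior[OF \<rho>] by (simp add: int_vertices_def)
        let ?p = "tensor d ([:-a, 1:] ^ k) (g j)"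
        have degk: "degree ([:-a, 1:] ^ k) \<le> deg_bound d" using k(1) by (simp only: degree_linear_power)
        \<comment> \<open>The two bounds on \<open>k\<close> force \<open>e a > 0\<close>, so the
          subtraction in \<open>e a\<close> is not truncated and the power reaches the order
          demanded by the transversal line.\<close>
        have "order_at d a + 1 \<le> k" using k unfolding e_def by linarith
        then have "tensor (\<not> d) (g j) ([:-a, 1:] ^ k) \<in> line_ideal (\<not> d) a"
          using degg[OF j] degk by (intro tensor_line_ideal le_imp_power_dvd) (simp_all only: not_not)
        then have p: "?p \<in> line_ideal (\<not> d) (coord (\<not> \<not> d) \<gamma>)" using \<gamma>(2) by (simp add: tensor_swap)
        have "at_vertex \<gamma> ?p \<in> X"
        proof (cases "at_vertex \<gamma> ?p \<in> boundaries")
          case False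
          then obtain \<rho>' where \<rho>': "\<rho>' \<in> MISd (\<not> d)" "\<gamma> \<in> \<rho>'"
            using vertex_cases[OF int p] by blast
          have MIS: "\<rho> \<in> MIS T" "\<rho>' \<in> MIS T" unfolding MIS_iff using \<rho> \<rho>'(1) by blast+
          then have "\<not> \<iota> \<rho> < \<iota> \<rho>'"
            using \<gamma>(1) \<rho>'(2) unfolding \<Gamma>_def Gamma_ord_def by auto
          \<comment> \<open>Injectivity of \<open>\<iota>\<close> would identify two segments of
            different directions. Hence \<open>\<rho>'\<close> is strictly earlier.\<close>
          moreover have "\<iota> \<rho>' \<noteq> \<iota> \<rho>"
          proof
            assume "\<iota> \<rho>' = \<iota> \<rho>"
            then have "\<rho>' = \<rho>"
              using \<iota> MIS unfolding is_ordering_def by (auto dest: inj_onD)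
            then show False using MISd_direction[OF \<rho>] \<rho>'(1) by auto
          qed
          ultimately have "spans_segment (\<not> d) X \<rho>'" using IH[OF \<rho>'(1)] by simp
          then show ?thesis using \<rho>'(2) \<gamma>\<rho>(1) p unfolding spans_segment_def by blast
        qed (use X(2) in blast)
        then show ?thesis using move[OF _ \<gamma>\<rho> \<gamma>0 ideal[OF degk j]] by simp
      qed
      ultimately have "rp.span (Q \<union> {[:-a, 1:] ^ k | a k. a \<in> coord d ` \<Gamma> \<and> k \<le> deg_bound d \<and> deg_bound d < k + e a}) \<subseteq> ?P"
        by (intro rp.span_minimal) auto
      then show ?thesis using Qspan[OF f] by blast
    qed
    show "spans_segment d X \<rho>"
      unfolding spans_segment_def
    proof (intro ballI)
      fix \<gamma> p assume \<gamma>: "\<gamma> \<in> vertices T \<inter> \<rho>" and "p \<in> line_ideal d (coord (\<not> d) \<gamma>)"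
      then have "p \<in> line_ideal d c" using level by auto
      then obtain F where F: "\<And>j. degree (F j) \<le> deg_bound d" "p = (\<Sum>j\<in>J. tensor d (F j) (g j))"
        unfolding J_def g_def r_def by (rule line_ideal_expand) blast
      have "at_vertex \<gamma> (tensor d (F j) (g j)) \<in> X" if "j \<in> J" for j
        using move[OF base[OF F(1) that] \<gamma>0 _ _ ideal[OF F(1) that]] \<gamma> by blast
      then show "at_vertex \<gamma> p \<in> X"
        unfolding F(2) at_vertex_sum by (intro fs.subspace_sum X(1))
    qed
  qed
qed

section \<open>Generators of the cokernel and their number\<close>

lemma vertex_ideal_split:
  assumes "\<gamma> \<in> int_vertices T" "p \<in> vertex_ideal T rh rv m m' \<gamma>"
  obtains q where "q False \<in> line_ideal False (coord True \<gamma>)" "q True \<in> line_ideal True (coord False \<gamma>)"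
    "p = q False + q True"
proof -
  obtain q0 q1 \<tau>v \<tau>h where *: "p = q0 + q1" "\<tau>v \<in> vedges T" "\<gamma> \<in> \<tau>v" "\<tau>h \<in> hedges T" "\<gamma> \<in> \<tau>h"
    "q0 \<in> edge_ideal rh rv m m' \<tau>v" "q1 \<in> edge_ideal rh rv m m' \<tau>h"
    using assms(2) unfolding vertex_ideal_def by blast
  have "is_seg False \<tau>v" "is_seg True \<tau>h" using * by (auto simp: vedges_def hedges_def is_seg_def)
  then have "q0 \<in> line_ideal False (coord True \<gamma>)" "q1 \<in> line_ideal True (coord False \<gamma>)"
    using * edge_ideal_eq(1)[of False \<tau>v \<gamma>] edge_ideal_eq(1)[of True \<tau>h \<gamma>] by auto
  then show ?thesis using *(1) by (intro that[of "\<lambda>d. if d then q1 else q0"]) auto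
qed

text \<open>One set from \<open>segment_step\<close> is chosen for each segment. Their union
  generates the cokernel, and its cardinality is at most the sum of the separate bounds.\<close>

lemma h_dim_le:
  assumes \<iota>: "is_ordering T \<iota>"
  shows "int (h_dim T rh rv m m') \<le> (\<Sum>d\<in>UNIV. \<Sum>\<rho>\<in>MISd d.
    max 0 (int (deg_bound d) + 1 - weight T rh rv m m' \<iota> \<rho>) *
    max 0 (int (deg_bound (\<not> d)) - int (seg_smoothness T rh rv \<rho>)))"
proof -
  define bound where "bound d \<rho> = max 0 (int (deg_bound d) + 1 - weight T rh rv m m' \<iota> \<rho>) *
    max 0 (int (deg_bound (\<not> d)) - int (seg_smoothness T rh rv \<rho>))" for d \<rho>
  define good where "good d \<rho> S \<longleftrightarrow> finite S \<and> int (card S) \<le> bound d \<rho> \<and>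
    (\<forall>X. fs.subspace X \<longrightarrow> boundaries \<subseteq> X \<longrightarrow> S \<subseteq> X \<longrightarrow>
      (\<forall>\<rho>'\<in>MISd (\<not> d). \<iota> \<rho>' < \<iota> \<rho> \<longrightarrow> spans_segment (\<not> d) X \<rho>') \<longrightarrow> spans_segment d X \<rho>)"
    for d \<rho> S
  have ex: "\<exists>S. \<rho> \<in> MISd d \<longrightarrow> good d \<rho> S" for d \<rho>
  proof (cases "\<rho> \<in> MISd d")
    case True
    show ?thesis
    proof (rule segment_step[OF \<iota> True])
      fix S assume "finite S"
        "int (card S) \<le> max 0 (int (deg_bound d) + 1 - weight T rh rv m m' \<iota> \<rho>) *
           max 0 (int (deg_bound (\<not> d)) - int (seg_smoothness T rh rv \<rho>))"
        "\<And>X. fs.subspace X \<Longrightarrow> boundaries \<subseteq> X \<Longrightarrow> S \<subseteq> X \<Longrightarrow>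
          (\<And>\<rho>'. \<rho>' \<in> MISd (\<not> d) \<Longrightarrow> \<iota> \<rho>' < \<iota> \<rho> \<Longrightarrow> spans_segment (\<not> d) X \<rho>') \<Longrightarrow>
          spans_segment d X \<rho>"
      then have "good d \<rho> S" unfolding good_def bound_def by simp
      then show ?thesis by blast
    qed
  qed simp
  define S where "S d \<rho> = (SOME S. good d \<rho> S)" for d \<rho>
  have S: "good d \<rho> (S d \<rho>)" if "\<rho> \<in> MISd d" for d \<rho>
    using ex[of \<rho> d] that unfolding S_def by (auto intro: someI)
  define S' where "S' = (\<Union>d. \<Union>\<rho>\<in>MISd d. S d \<rho>)"
  have "finite S'" unfolding S'_def using S finite_MISd by (intro finite_UN_I) (auto simp: good_def)
  define X where "X = fs.span (boundaries \<union> S')"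
  have X: "fs.subspace X" unfolding X_def by (rule fs.subspace_span)
  have sup: "boundaries \<subseteq> X" "S' \<subseteq> X" unfolding X_def using fs.span_superset by blast+
  \<comment> \<open>The induction on \<open>\<iota> \<rho>\<close> covers both directions at once,
    because \<open>segment_step\<close> relies on earlier segments of the other direction.\<close>
  have spans: "spans_segment d X \<rho>" if "\<rho> \<in> MISd d" for d \<rho>
    using that
  proof (induction "\<iota> \<rho>" arbitrary: d \<rho> rule: less_induct)
    case less
    have "S d \<rho> \<subseteq> X" using sup(2) less.prems unfolding S'_def by blast
    then show ?case using S[OF less.prems] X sup(1) less.hyps unfolding good_def by simp
  qed
  \<comment> \<open>Such a class is a boundary or belongs to a maximal interior segment, whose
    classes are already in \<open>X\<close>.\<close>
  have at_vertex_X: "at_vertex x p \<in> X" if "x \<in> int_vertices T" "p \<in> line_ideal d (coord (\<not> d) x)" for x p d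
    using vertex_cases[OF that] spans sup(1) that unfolding spans_segment_def int_vertices_def by blast
  have "direct_sum (int_vertices T) (vertex_ideal T rh rv m m') \<subseteq> X"
  proof
    fix v assume v: "v \<in> direct_sum (int_vertices T) (vertex_ideal T rh rv m m')"
    have fin: "finite (int_vertices T)" using finite_vertices by (simp add: int_vertices_def)
    have "v = (\<Sum>\<gamma>\<in>int_vertices T. at_vertex \<gamma> (v \<gamma>))"
    proof
      fix x
      have "(\<Sum>\<gamma>\<in>A. at_vertex \<gamma> (v \<gamma>)) x = (\<Sum>\<gamma>\<in>A. at_vertex \<gamma> (v \<gamma>) x)" for A
        by (induction A rule: infinite_finite_induct) auto
      then have "(\<Sum>\<gamma>\<in>int_vertices T. at_vertex \<gamma> (v \<gamma>)) x = (\<Sum>\<gamma>\<in>int_vertices T. at_vertex \<gamma> (v \<gamma>) x)" .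
      also have "\<dots> = (\<Sum>\<gamma>\<in>int_vertices T. if \<gamma> = x then v \<gamma> else 0)"
        by (intro sum.cong) (auto simp: at_vertex_def)
      also have "\<dots> = (if x \<in> int_vertices T then v x else 0)" using fin by simp
      also have "\<dots> = v x" using v unfolding direct_sum_def by (cases x) simp
      finally show "v x = (\<Sum>\<gamma>\<in>int_vertices T. at_vertex \<gamma> (v \<gamma>)) x" by (rule sym)
    qed
    moreover have "at_vertex \<gamma> (v \<gamma>) \<in> X" if \<gamma>: "\<gamma> \<in> int_vertices T" for \<gamma>
    proof -
      have "v \<gamma> \<in> vertex_ideal T rh rv m m' \<gamma>" using v \<gamma> unfolding direct_sum_def by blast
      then obtain q where q: "q False \<in> line_ideal False (coord True \<gamma>)" "q True \<in> line_ideal True (coord False \<gamma>)"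
        "v \<gamma> = q False + q True"
        using vertex_ideal_split[OF \<gamma>] by metis
      have "at_vertex \<gamma> (q False) \<in> X" "at_vertex \<gamma> (q True) \<in> X"
        using q(1,2) at_vertex_X[OF \<gamma>, of "q False" False] at_vertex_X[OF \<gamma>, of "q True" True] by simp_all
      then show ?thesis unfolding q(3) at_vertex_linear by (rule fs.subspace_add[OF X])
    qed
    ultimately show "v \<in> X" using fs.subspace_sum[OF X] by metis
  qed
  then have "h_dim T rh rv m m' \<le> card S'"
    unfolding h_dim_def boundaries_def[symmetric] X_def by (intro quotient_dim_le subspace_boundaries \<open>finite S'\<close>)
  also have "card S' \<le> (\<Sum>d\<in>UNIV. \<Sum>\<rho>\<in>MISd d. card (S d \<rho>))"
    unfolding S'_def using finite_MISd
    by (intro order_trans[OF card_UN_le] sum_mono) (auto intro: card_UN_le)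
  finally have "int (h_dim T rh rv m m') \<le> int (\<Sum>d\<in>UNIV. \<Sum>\<rho>\<in>MISd d. card (S d \<rho>))"
    by (rule of_nat_mono)
  also have "\<dots> = (\<Sum>d\<in>UNIV. \<Sum>\<rho>\<in>MISd d. int (card (S d \<rho>)))" by simp
  also have "\<dots> \<le> (\<Sum>d\<in>UNIV. \<Sum>\<rho>\<in>MISd d. bound d \<rho>)" using S by (intro sum_mono) (simp add: good_def)
  finally show ?thesis unfolding bound_def .
qed

end

text \<open>The factors counting transversal exponents are also truncated at 0: once the order
  reaches the transversal degree bound, the ideal of the line is zero and the segment contributes
  nothing.\<close>

theorem theorem3p7:
  fixes T :: tmesh and rh rv :: "real \<Rightarrow> nat" and m m' :: nat and \<iota> :: "pt set \<Rightarrow> nat"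
  assumes "is_tmesh T"
    and "is_ordering T \<iota>"
  shows "0 \<le> int (h_dim T rh rv m m') \<and>
    int (h_dim T rh rv m m') \<le>
      (\<Sum>\<rho>\<in>MIS_h T. max 0 (int m + 1 - weight T rh rv m m' \<iota> \<rho>) *
                      max 0 (int m' - int (seg_smoothness T rh rv \<rho>))) +
      (\<Sum>\<rho>\<in>MIS_v T. max 0 (int m - int (seg_smoothness T rh rv \<rho>)) *
                      max 0 (int m' + 1 - weight T rh rv m m' \<iota> \<rho>))"
proof -
  interpret spline T rh rv m m' by unfold_locales (rule assms(1))
  have "MISd True = MIS_h T" "MISd False = MIS_v T" "deg_bound True = m" "deg_bound False = m'"
    by (simp_all add: MISd_def deg_bound_def)
  then show ?thesis using h_dim_le[OF assms(2)] by (simp add: UNIV_bool mult.commute add.commute)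
qed

end
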